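(* Let $0<\epsilon\le \beta_{\min}/2$, let $\delta\in(0,1/2)$ and let $\theta^\star\in\Theta$. Every fixed-confidence causal learning algorithm $(\pi,\tau_\delta,\widehat\theta)$ with actions in $\mathcal A_\infty$ that is $(\epsilon,\delta)$-correct over $\Theta$ satisfies $$\mathbb E_{\theta^\star}[\tau_\delta]\;\ge\;\frac{\operatorname{kl}(1-\delta,\delta)}{C_{2\epsilon}(\theta^\star)} .$$ Consequently, for any family of algorithms indexed by $\delta$ such that the algorithm with index $\delta$ is $(\epsilon,\delta)$-correct over $\Theta$ and has stopping time $\tau_\delta$, $$\liminf_{\delta\downarrow 0}\frac{\mathbb E_{\theta^\star}[\tau_\delta]}{\log(1/\delta)}\;\ge\;\frac1{C_{2\epsilon}(\theta^\star)} .$$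
   Context: **Model.** Fix an integer $p\ge1$, $[p]=\{1,\dots,p\}$, intervals $[U_{j,1},U_{j,2}]$ ($j\in[p]$), and constants $\beta_{\min},A_{\max},\sigma_{\min},\sigma_{\max},C_{\max}>0$ with $\max_j\max_{u\in[U_{j,1},U_{j,2}]}|u|\le C_{\max}$. $\Theta$ is the set of all triples $\theta=(D,\mathbf A,\mathbf\Sigma)$ where $D$ is a directed acyclic graph (DAG) on $[p]$; $\mathbf A\in\mathbb R^{p\times p}$ satisfies $A_{jk}\ne0$ if and only if $k\to j$ is an edge of $D$, and $\beta_{\min}\le|A_{jk}|\le A_{\max}$ for every nonzero $A_{jk}$; and $\mathbf\Sigma=\operatorname{diag}(\sigma_1^2,\dots,\sigma_p^2)$ with $\sigma_{\min}^2\le\sigma_j^2\le\sigma_{\max}^2$. The associated linear Gaussian structural equation model is $\mathbf X=\mathbf A\mathbf X+\mathbf e$, $\mathbf e\sim\mathcal N(0,\mathbf\Sigma)$. **Actions and distributions.** $\mathcal A_\infty=\{0\}\cup\{(j,u):j\in[p],u\in[U_{j,1},U_{j,2}]\}$ (with its Borel $\sigma$-algebra), where $0$ is passive observation and $(j,u)$ is the perfect intervention $\operatorname{do}(X_j=u)$. $P_0^\theta=\mathcal N(0,(\mathbf I-\mathbf A)^{-1}\mathbf\Sigma(\mathbf I-\mathbf A)^{-\mathsf T})$ on $\mathbb R^p$; for $a=(j,u)$ and $R=[p]\setminus\{j\}$, $P_a^\theta=\mathcal N\big((\mathbf I-\mathbf A_{R,R})^{-1}\mathbf A_{R,j}u,\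 (\mathbf I-\mathbf A_{R,R})^{-1}\mathbf\Sigma_{R,R}(\mathbf I-\mathbf A_{R,R})^{-\mathsf T}\big)$ on $\mathbb R^{R}$ (the law of the non-degenerate coordinates). **Algorithms.** At each round $t\ge1$ the learner selects $a_t\in\mathcal A_\infty$ through a rule $\pi_t$ (a probability kernel, in particular possibly a deterministic function, not depending on the unknown parameter) based on the history $(a_1,\mathbf X_1,\dots,a_{t-1},\mathbf X_{t-1})$, and then, given the past and $a_t$, observes $\mathbf X_t\sim P^{\theta^\star}_{a_t}$. $\mathcal F_t=\sigma(a_1,\mathbf X_1,\dots,a_t,\mathbf X_t)$. A fixed-confidence causal learning algorithm is $(\pi,\tau_\delta,\widehat\theta)$ with $\pi=(\pi_t)$ such a policy, $\tau_\delta$ an $(\mathcal F_t)$-stopping time (possibly infinite), and $\widehat\theta_t=(\widehat D_t,\widehat{\mathbf A}_t,\widehat{\mathbf\Sigma}_t)$ an adapted estimator sequence. $\mathbb P_{\theta},\mathbb E_{\theta}$ denote probability and expectation when the true parameter is $\theta$. **Correctness.** With $\|\mathbf M\|_{\max}=\max_{j,k}|M_{jk}|$, the algorithm is $(\epsilon,\delta)$-correct over $\Theta$ if for every $\theta^\star=(D^\star,\mathbf A^\star,\mathbf\Sigma^\star)\in\Theta$, $\mathbb P_{\theta^\star}(\tau_\delta<\infty,\ \widehat D_{\tau_\delta}=D^\star,\ \|\widehat{\mathbf A}_{\tau_\delta}-\mathbf A^\star\|_{\max}<\epsilon)\ge1-\delta$. **Information complexity.** For $r>0$, $\operatorname{Alt}_r(\theta)=\{\lambda\in\Theta: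 D^\lambda\ne D^\theta\text{ or }\|\mathbf A^\lambda-\mathbf A^\theta\|_{\max}\ge r\}$ and $$C_r(\theta)=\sup_{w\in\mathcal P(\mathcal A_\infty)}\ \inf_{\lambda\in\operatorname{Alt}_r(\theta)}\int_{\mathcal A_\infty}\operatorname{KL}(P_a^\theta\|P_a^\lambda)\,w(\mathrm da),$$ where $\mathcal P(\mathcal A_\infty)$ is the set of probability measures on $\mathcal A_\infty$. $\operatorname{KL}$ is the Kullback–Leibler divergence and $\operatorname{kl}(x,y)=x\log(x/y)+(1-x)\log((1-x)/(1-y))$. *)

theory Defs
  imports "HOL-Probability.Probability"
begin

section \<open>The model\<close>

text \<open>
  The node set \<open>[p]\<close> is a finite type \<open>'p\<close>, so that \<open>p = CARD('p) \<ge> 1\<close> is arbitrary.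
\<close>

record 'p setting =
  lo :: "'p \<Rightarrow> real"
  hi :: "'p \<Rightarrow> real"
  beta_min :: real
  A_max :: real
  sigma_min :: real
  sigma_max :: real
  C_max :: real

definition valid_setting :: "'p::finite setting \<Rightarrow> bool" where
  "valid_setting S \<longleftrightarrow>
     (\<forall>j. lo S j \<le> hi S j) \<and> (\<forall>j. \<forall>u\<in>{lo S j..hi S j}. \<bar>u\<bar> \<le> C_max S) \<and>
     0 < beta_min S \<and> 0 < A_max S \<and> 0 < sigma_min S \<and> 0 < sigma_max S \<and> 0 < C_max S"

text \<open>An edge \<open>k \<rightarrow> j\<close> of the graph is the pair \<open>(k, j)\<close>.\<close>

record 'p sem =
  graph :: "('p \<times> 'p) set"
  coef :: "real^'p^'p"
  ncov :: "real^'p^'p"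

definition Theta :: "'p::finite setting \<Rightarrow> 'p sem set" where
  "Theta S = {\<theta>. acyclic (graph \<theta>) \<and>
     (\<forall>j k. coef \<theta> $ j $ k \<noteq> 0 \<longleftrightarrow> (k, j) \<in> graph \<theta>) \<and>
     (\<forall>j k. coef \<theta> $ j $ k \<noteq> 0 \<longrightarrow>
        beta_min S \<le> \<bar>coef \<theta> $ j $ k\<bar> \<and> \<bar>coef \<theta> $ j $ k\<bar> \<le> A_max S) \<and>
     (\<exists>\<sigma>. ncov \<theta> = (\<chi> j k. if j = k then (\<sigma> j)\<^sup>2 else 0) \<and>
        (\<forall>j. (sigma_min S)\<^sup>2 \<le> (\<sigma> j)\<^sup>2 \<and> (\<sigma> j)\<^sup>2 \<le> (sigma_max S)\<^sup>2))}"


section \<open>Actions and interventional distributions\<close>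

text \<open>
  \<open>(None, 0)\<close> is passive observation and \<open>(Some j, u)\<close> is \<open>do(X\<^sub>j = u)\<close>. The Borel
  \<open>\<sigma>\<close>-algebra is the trace of the one on (discrete) \<open>\<times>\<close> (real line).
\<close>

type_synonym 'p action = "'p option \<times> real"

definition actions :: "'p setting \<Rightarrow> 'p action set" where
  "actions S = {(None, 0)} \<union> {(Some j, u) | j u. u \<in> {lo S j..hi S j}}"

definition action_space :: "'p setting \<Rightarrow> 'p action measure" where
  "action_space S = restrict_space (count_space UNIV \<Otimes>\<^sub>M borel) (actions S)"

text \<open>
  \<open>sub_mat R M\<close> is the principal submatrix \<open>M\<^sub>R\<^sub>,\<^sub>R\<close>, completed to a full matrix by an identity
  block on the complement of \<open>R\<close>. It is block diagonal, so its determinant is that of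
  \<open>M\<^sub>R\<^sub>,\<^sub>R\<close>, and products, transposes and inverses of such matrices are again the completions
  of the products, transposes and inverses of the \<open>R\<close>-blocks.
\<close>

definition sub_mat :: "'p::finite set \<Rightarrow> real^'p^'p \<Rightarrow> real^'p^'p" where
  "sub_mat R M = (\<chi> i k. if i \<in> R \<and> k \<in> R then M $ i $ k else if i = k then 1 else 0)"

text \<open>
  The nondegenerate normal law \<open>N(m\<^sub>R, V\<^sub>R\<^sub>,\<^sub>R)\<close> on \<open>\<real>\<^sup>R\<close>, by its Lebesgue density;
  only the \<open>R\<close>-entries of \<open>m\<close> and \<open>V\<close> matter.
\<close>

definition mv_normal :: "'p::finite set \<Rightarrow> real^'p \<Rightarrow> real^'p^'p \<Rightarrow> ('p \<Rightarrow> real) measure" where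
  "mv_normal R m V = density (PiM R (\<lambda>_. lborel)) (\<lambda>x. ennreal (
     exp (- (\<Sum>i\<in>R. \<Sum>k\<in>R. (x i - m $ i) * matrix_inv (sub_mat R V) $ i $ k * (x k - m $ k)) / 2)
     / sqrt ((2 * pi) ^ card R * det (sub_mat R V))))"

definition obs_law :: "'p::finite sem \<Rightarrow> ('p \<Rightarrow> real) measure" where
  "obs_law \<theta> = (let B = matrix_inv (mat 1 - coef \<theta>)
     in mv_normal UNIV 0 (B ** ncov \<theta> ** transpose B))"

definition do_law :: "'p::finite sem \<Rightarrow> 'p \<Rightarrow> real \<Rightarrow> ('p \<Rightarrow> real) measure" where
  "do_law \<theta> j u = (let R = UNIV - {j}; B = matrix_inv (sub_mat R (mat 1 - coef \<theta>))
     in mv_normal R (B *v (\<chi> i. if i \<in> R then coef \<theta> $ i $ j * u else 0))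
          (B ** sub_mat R (ncov \<theta>) ** transpose B))"

definition law :: "'p::finite sem \<Rightarrow> 'p action \<Rightarrow> ('p \<Rightarrow> real) measure" where
  "law \<theta> a = (case a of (None, _) \<Rightarrow> obs_law \<theta> | (Some j, u) \<Rightarrow> do_law \<theta> j u)"

text \<open>
  So that observations under all actions live in one space, the learner is shown the full vector
  in \<open>\<real>\<^sup>p\<close>, with \<open>X\<^sub>j = u\<close> filled in under \<open>do(X\<^sub>j = u)\<close>.
\<close>

definition full_vec :: "'p::finite action \<Rightarrow> ('p \<Rightarrow> real) \<Rightarrow> real^'p" where
  "full_vec a x = (\<chi> i. if fst a = Some i then snd a else x i)"

definition sample_law :: "'p::finite sem \<Rightarrow> 'p action \<Rightarrow> (real^'p) measure" where
  "sample_law \<theta> a = distr (law \<theta> a) borel (full_vec a)"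


section \<open>Algorithms\<close>

text \<open>
  Coordinate \<open>i\<close> of a trajectory holds the action and observation of round \<open>i + 1\<close>;
  \<open>policy \<A> i\<close> chooses the action of that round from the history on \<open>{0..<i}\<close>.
\<close>

type_synonym 'p trajectory = "nat \<Rightarrow> 'p action \<times> (real^'p)"

record 'p algorithm =
  policy :: "nat \<Rightarrow> 'p trajectory \<Rightarrow> 'p action measure"
  stop :: "'p trajectory \<Rightarrow> enat"
  estimate :: "nat \<Rightarrow> 'p trajectory \<Rightarrow> 'p sem"

definition round_space :: "'p::finite setting \<Rightarrow> ('p action \<times> (real^'p)) measure" where
  "round_space S = action_space S \<Otimes>\<^sub>M borel"

text \<open>\<open>history S t\<close> is \<open>\<F>\<^sub>t\<close>, generated by the first \<open>t\<close> rounds (all rounds for \<open>t = \<infinity>\<close>).\<close>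

definition history :: "'p::finite setting \<Rightarrow> enat \<Rightarrow> 'p trajectory measure" where
  "history S t = vimage_algebra (space (PiM UNIV (\<lambda>_. round_space S)))
     (\<lambda>\<omega>. restrict \<omega> {i. enat i < t}) (PiM {i. enat i < t} (\<lambda>_. round_space S))"

definition is_algorithm :: "'p::finite setting \<Rightarrow> 'p algorithm \<Rightarrow> bool" where
  "is_algorithm S \<A> \<longleftrightarrow>
     (\<forall>i. policy \<A> i \<in> PiM {0..<i} (\<lambda>_. round_space S) \<rightarrow>\<^sub>M prob_algebra (action_space S)) \<and>
     stopping_time (history S) (stop \<A>) \<and>
     (\<forall>t. (\<lambda>\<omega>. graph (estimate \<A> t \<omega>)) \<in> history S (enat t) \<rightarrow>\<^sub>M count_space UNIV \<and>
          (\<lambda>\<omega>. coef (estimate \<A> t \<omega>)) \<in> borel_measurable (history S (enat t)) \<and>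
          (\<lambda>\<omega>. ncov (estimate \<A> t \<omega>)) \<in> borel_measurable (history S (enat t)))"

definition round_kernel ::
  "'p::finite setting \<Rightarrow> 'p algorithm \<Rightarrow> 'p sem \<Rightarrow> nat \<Rightarrow> 'p trajectory
     \<Rightarrow> ('p action \<times> (real^'p)) measure" where
  "round_kernel S \<A> \<theta> i h =
     policy \<A> i h \<bind> (\<lambda>a. distr (sample_law \<theta> a) (round_space S) (\<lambda>x. (a, x)))"

text \<open>The law of the whole trajectory under \<open>\<theta>\<close>, by the Ionescu-Tulcea theorem.\<close>

definition traj_law :: "'p::finite setting \<Rightarrow> 'p algorithm \<Rightarrow> 'p sem \<Rightarrow> 'p trajectory measure" where
  "traj_law S \<A> \<theta> = projective_family.lim UNIV
     (Ionescu_Tulcea.CI (round_kernel S \<A> \<theta>) (\<lambda>_. round_space S)) (\<lambda>_. round_space S)"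

definition expected_stop :: "'p::finite setting \<Rightarrow> 'p algorithm \<Rightarrow> 'p sem \<Rightarrow> ennreal" where
  "expected_stop S \<A> \<theta> = (\<integral>\<^sup>+ \<omega>. ennreal_of_enat (stop \<A> \<omega>) \<partial>traj_law S \<A> \<theta>)"

definition max_norm :: "real^'p::finite^'p \<Rightarrow> real" where
  "max_norm M = Max {\<bar>M $ j $ k\<bar> | j k. True}"

definition correct_alg :: "'p::finite setting \<Rightarrow> real \<Rightarrow> real \<Rightarrow> 'p algorithm \<Rightarrow> bool" where
  "correct_alg S \<epsilon> \<delta> \<A> \<longleftrightarrow> (\<forall>\<theta>\<in>Theta S.
     measure (traj_law S \<A> \<theta>) {\<omega> \<in> space (traj_law S \<A> \<theta>).
        stop \<A> \<omega> < \<infinity> \<and>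
        graph (estimate \<A> (the_enat (stop \<A> \<omega>)) \<omega>) = graph \<theta> \<and>
        max_norm (coef (estimate \<A> (the_enat (stop \<A> \<omega>)) \<omega>) - coef \<theta>) < \<epsilon>} \<ge> 1 - \<delta>)"


section \<open>Information complexity\<close>

definition Alt :: "'p::finite setting \<Rightarrow> real \<Rightarrow> 'p sem \<Rightarrow> 'p sem set" where
  "Alt S r \<theta> = {\<eta> \<in> Theta S. graph \<eta> \<noteq> graph \<theta> \<or> max_norm (coef \<eta> - coef \<theta>) \<ge> r}"

text \<open>
  The library's \<open>KL_divergence b M N\<close> is \<open>KL(N \<parallel> M)\<close> to base \<open>b\<close>; it is real-valued, which
  loses nothing here because the normal laws compared always have finite divergence.
\<close>

definition KL :: "'a measure \<Rightarrow> 'a measure \<Rightarrow> real" where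
  "KL P Q = KL_divergence (exp 1) Q P"

text \<open>Extended nonnegative values: the infimum over an empty set of alternatives is \<open>\<infinity>\<close>.\<close>

definition info_complexity :: "'p::finite setting \<Rightarrow> real \<Rightarrow> 'p sem \<Rightarrow> ennreal" where
  "info_complexity S r \<theta> =
     (SUP w \<in> {w. prob_space w \<and> sets w = sets (action_space S)}.
        INF \<eta> \<in> Alt S r \<theta>. \<integral>\<^sup>+ a. ennreal (KL (law \<theta> a) (law \<eta> a)) \<partial>w)"

definition kl :: "real \<Rightarrow> real \<Rightarrow> real" where
  "kl x y = x * ln (x / y) + (1 - x) * ln ((1 - x) / (1 - y))"

end

theory Submission
  imports Defs "HOL-Real_Asymp.Real_Asymp"
begin

text \<open>
  For an alternative \<open>\<eta>\<close>, let \<open>E\<close> be the event that the algorithm stops and answers \<open>\<theta>\<close> up to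
  \<open>\<epsilon>\<close>. By correctness \<open>E\<close> has probability at least \<open>1 - \<delta>\<close> under \<open>\<theta>\<close> and at most \<open>\<delta>\<close> under
  \<open>\<eta>\<close>. Let \<open>Z\<close> be the log-likelihood ratio of \<open>\<theta>\<close> against \<open>\<eta>\<close> at the stopping time truncated at
  \<open>n\<close>. Bounding \<open>- Z = ln (exp (- Z))\<close> by tangents of the logarithm, one on \<open>E\<close> and another off \<open>E\<close>,
  and integrating turns these two probabilities into the lower bound \<open>kl (1 - \<delta>) \<delta>\<close> for the
  expectation of \<open>Z\<close> as \<open>n\<close> tends to infinity. On the other hand this expectation is the expected sum,
  over the rounds before stopping, of the divergences of the chosen actions (Wald), that is, the
  expected stopping time times the average divergence under the normalised visit measure of the
  actions. This visit measure does not depend on \<open>\<eta>\<close>, so the infimum over \<open>\<eta>\<close> can be taken.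

  The Gaussian laws enter only through their densities and second moments. Along a directed acyclic
  graph the density is a product of normal densities of the residuals, which is integrated by
  eliminating sinks one at a time; no linear change of variables is needed.
\<close>

section \<open>Linear Gaussian structural equation models\<close>

text \<open>A sink of \<open>R\<close> occurs in no residual but its own, so integrating it out
  first only translates one factor, and the other factors form the same expression on the smaller
  set. Acyclicity supplies a sink at every stage.\<close>

lemma nn_integral_acyclic_residuals:
  fixes A :: "'i \<Rightarrow> 'i \<Rightarrow> real" and g :: "'i \<Rightarrow> real \<Rightarrow> ennreal"
  assumes "finite R" and "finite G" and "acyclic G"
    and A: "\<And>i k. A i k \<noteq> 0 \<Longrightarrow> (k, i) \<in> G"
    and g[measurable]: "\<And>i. g i \<in> borel_measurable borel"
  shows "(\<integral>\<^sup>+x. (\<Prod>i\<in>R. g i (x i - (\<Sum>k\<in>R. A i k * x k) - c i)) \<partial>PiM R (\<lambda>_. lborel))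
    = (\<Prod>i\<in>R. \<integral>\<^sup>+y. g i y \<partial>lborel)"
  using \<open>finite R\<close>
proof (induction "card R" arbitrary: R)
  case 0
  then show ?case by (simp add: PiM_empty)
next
  case (Suc n)
  interpret product_sigma_finite "\<lambda>_::'i. lborel :: real measure"
    by unfold_locales
  \<comment> \<open>A node of \<open>R\<close> that is minimal for the converse of \<open>G\<close>
    has no child in \<open>R\<close>.\<close>
  have wf: "wf (G\<inverse>)"
    using assms by (intro finite_acyclic_wf_converse)
  obtain r where "r \<in> R" using Suc by fastforce
  then obtain s where s: "s \<in> R" and "\<And>i. (i, s) \<in> G\<inverse> \<Longrightarrow> i \<notin> R"
    by (rule wfE_min[OF wf]) blast
  then have sink: "(s, i) \<notin> G" if "i \<in> R" for i
    using that by blast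
  define R' where "R' = R - {s}"
  have R: "R = insert s R'" "s \<notin> R'" "finite R'" "card R' = n"
    using s Suc by (auto simp: R'_def)
  have A0: "A i s = 0" if "i \<in> R" for i
    using sink[OF that] A by blast
  have sumR: "(\<Sum>k\<in>R. A i k * x k) = (\<Sum>k\<in>R'. A i k * x k)" if "i \<in> R" for i and x :: "'i \<Rightarrow> real"
    using R A0[OF that] by simp
  have [measurable]: "(\<lambda>x. x i) \<in> borel_measurable (PiM R (\<lambda>_. lborel))" if "i \<in> R" for i
    using measurable_component_singleton[OF that, of "\<lambda>_. lborel"] by simp
  have [measurable]: "(\<lambda>x. x i) \<in> borel_measurable (PiM R' (\<lambda>_. lborel))" if "i \<in> R'" for i
    using measurable_component_singleton[OF that, of "\<lambda>_. lborel"] by simp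
  let ?h = "\<lambda>x. \<Prod>i\<in>R'. g i (x i - (\<Sum>k\<in>R'. A i k * x k) - c i)"
  have "(\<integral>\<^sup>+x. (\<Prod>i\<in>R. g i (x i - (\<Sum>k\<in>R. A i k * x k) - c i)) \<partial>PiM R (\<lambda>_. lborel))
      = (\<integral>\<^sup>+x. (\<integral>\<^sup>+y. (\<Prod>i\<in>R. g i ((x(s := y)) i - (\<Sum>k\<in>R. A i k * (x(s := y)) k) - c i)) \<partial>lborel)
          \<partial>PiM R' (\<lambda>_. lborel))"
    unfolding R(1)
    by (rule product_nn_integral_insert) (use R in \<open>simp_all flip: R(1)\<close>)
  also have "\<dots> = (\<integral>\<^sup>+x. (\<integral>\<^sup>+y. g s (y - (\<Sum>k\<in>R'. A s k * x k) - c s) * ?h x \<partial>lborel)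
          \<partial>PiM R' (\<lambda>_. lborel))"
  proof (intro nn_integral_cong)
    fix x :: "'i \<Rightarrow> real" and y :: real
    let ?x = "x(s := y)"
    have sum': "(\<Sum>k\<in>R. A i k * ?x k) = (\<Sum>k\<in>R'. A i k * x k)" if "i \<in> R" for i
      unfolding sumR[OF that] using R by (intro sum.cong) auto
    have "(\<Prod>i\<in>R. g i (?x i - (\<Sum>k\<in>R. A i k * ?x k) - c i))
      = (\<Prod>i\<in>R. g i (?x i - (\<Sum>k\<in>R'. A i k * x k) - c i))"
      by (intro prod.cong refl) (simp only: sum')
    also have "\<dots> = g s (y - (\<Sum>k\<in>R'. A s k * x k) - c s)
        * (\<Prod>i\<in>R'. g i (?x i - (\<Sum>k\<in>R'. A i k * x k) - c i))"
      using R by (simp add: prod.insert)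
    also have "(\<Prod>i\<in>R'. g i (?x i - (\<Sum>k\<in>R'. A i k * x k) - c i)) = ?h x"
      using R by (intro prod.cong) auto
    finally show "(\<Prod>i\<in>R. g i (?x i - (\<Sum>k\<in>R. A i k * ?x k) - c i))
      = g s (y - (\<Sum>k\<in>R'. A s k * x k) - c s) * ?h x" .
  qed
  \<comment> \<open>Translating \<open>y\<close> by the terms in \<open>x\<close> leaves the
    integral over the line unchanged, and \<open>?h x\<close> does not involve
    \<open>y\<close>.\<close>
  also have "\<dots> = (\<integral>\<^sup>+x. (\<integral>\<^sup>+y. g s y \<partial>lborel) * ?h x \<partial>PiM R' (\<lambda>_. lborel))"
  proof (intro nn_integral_cong)
    fix x :: "'i \<Rightarrow> real"
    have "(\<integral>\<^sup>+y. g s (y - (\<Sum>k\<in>R'. A s k * x k) - c s) \<partial>lborel) = (\<integral>\<^sup>+y. g s y \<partial>lborel)"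
      using nn_integral_real_affine[of "\<lambda>y. g s (y - (\<Sum>k\<in>R'. A s k * x k) - c s)" 1
          "(\<Sum>k\<in>R'. A s k * x k) + c s"] by simp
    then show "(\<integral>\<^sup>+y. g s (y - (\<Sum>k\<in>R'. A s k * x k) - c s) * ?h x \<partial>lborel)
        = (\<integral>\<^sup>+y. g s y \<partial>lborel) * ?h x"
      by (simp add: nn_integral_multc)
  qed
  also have "\<dots> = (\<integral>\<^sup>+y. g s y \<partial>lborel) * (\<integral>\<^sup>+x. ?h x \<partial>PiM R' (\<lambda>_. lborel))"
    by (intro nn_integral_cmult) simp
  also have "\<dots> = (\<Prod>i\<in>R. \<integral>\<^sup>+y. g i y \<partial>lborel)"
    using Suc(1)[of R'] R by simp
  finally show ?case .
qed

section \<open>Determinants and matrices with an identity block\<close>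

text \<open>Only the identity survives in the Leibniz expansion: for any other permutation take a
  moved node \<open>i\<close> none of whose parents is moved. Its image \<open>\<pi> i\<close> is
  moved as well, hence not a parent of \<open>i\<close>, and the entry at
  \<open>(i, \<pi> i)\<close> vanishes.\<close>

lemma det_unipotent_acyclic:
  fixes M :: "real^'n^'n"
  assumes "acyclic G"
    and diag: "\<And>i. M $ i $ i = 1"
    and off: "\<And>i k. i \<noteq> k \<Longrightarrow> M $ i $ k \<noteq> 0 \<Longrightarrow> (k, i) \<in> G"
  shows "det M = 1"
proof -
  have wf: "wf G"
    using assms by (intro finite_acyclic_wf) auto
  have 0: "of_int (sign \<pi>) * (\<Prod>i\<in>UNIV. M $ i $ \<pi> i) = 0" if \<pi>: "\<pi> permutes UNIV" "\<pi> \<noteq> id" for \<pi>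
  proof -
    obtain j where "j \<in> {i. \<pi> i \<noteq> i}" using \<pi>(2) by fastforce
    then obtain i where "i \<in> {i. \<pi> i \<noteq> i}" and "\<And>k. (k, i) \<in> G \<Longrightarrow> k \<notin> {i. \<pi> i \<noteq> i}"
      by (rule wfE_min[OF wf]) blast
    then have i: "\<pi> i \<noteq> i" and min: "\<And>k. (k, i) \<in> G \<Longrightarrow> \<pi> k = k"
      by auto
    have "\<pi> (\<pi> i) \<noteq> \<pi> i"
      using i permutes_inj[OF \<pi>(1)] by (auto dest: injD)
    then have "(\<pi> i, i) \<notin> G" using min by blast
    then have "M $ i $ \<pi> i = 0" using off[of i "\<pi> i"] i by auto
    then show ?thesis by (auto intro!: prod_zero)
  qed
  have "det M = (\<Sum>\<pi>\<in>{id}. of_int (sign \<pi>) * (\<Prod>i\<in>UNIV. M $ i $ \<pi> i))"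
    unfolding det_def
  proof (rule sum.mono_neutral_right)
    show "finite {p. p permutes (UNIV::'n set)}" by (simp add: finite_permutations)
  qed (use 0 permutes_id in auto)
  also have "\<dots> = 1" by (simp add: diag sign_id)
  finally show ?thesis .
qed

text \<open>The equation \<open>sub_mat R X = X\<close> singles out the matrices with an identity
  block off \<open>R\<close>. The lemmas below close this class under product, transpose and
  inverse, so that calculations with \<open>R\<close>-blocks can be run on full matrices.\<close>

lemma sub_mat_fixed_iff:
  "sub_mat R X = X \<longleftrightarrow> (\<forall>i k. i \<notin> R \<or> k \<notin> R \<longrightarrow> X $ i $ k = (if i = k then 1 else 0))"
  unfolding sub_mat_def vec_eq_iff by (auto split: if_splits)

lemma sub_mat_fixedD:
  assumes "sub_mat R X = X" "i \<notin> R \<or> k \<notin> R"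
  shows "X $ i $ k = (if i = k then 1 else 0)"
  using assms sub_mat_fixed_iff[of R X] by blast

lemma sub_mat_idem: "sub_mat R (sub_mat R X) = sub_mat R X"
  by (simp add: sub_mat_def vec_eq_iff)

lemma sub_mat_fixed_mult:
  assumes X: "sub_mat R X = X" and Y: "sub_mat R Y = Y"
  shows "sub_mat R (X ** Y) = X ** Y"
  unfolding sub_mat_fixed_iff
proof (intro allI impI)
  fix i k assume ik: "i \<notin> R \<or> k \<notin> R"
  show "(X ** Y) $ i $ k = (if i = k then 1 else 0)"
  proof (cases "i \<in> R")
    case False
    then have "(X ** Y) $ i $ k = (\<Sum>l\<in>UNIV. (if i = l then Y $ l $ k else 0))"
      by (simp only: matrix_matrix_mult_def vec_lambda_beta, intro sum.cong refl)
        (simp add: sub_mat_fixedD[OF X])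
    also have "\<dots> = (if i = k then 1 else 0)" using False sub_mat_fixedD[OF Y, of i k] by simp
    finally show ?thesis .
  next
    case True
    with ik have k: "k \<notin> R" by simp
    then have "(X ** Y) $ i $ k = (\<Sum>l\<in>UNIV. (if l = k then X $ i $ l else 0))"
      by (simp only: matrix_matrix_mult_def vec_lambda_beta, intro sum.cong refl)
        (simp add: sub_mat_fixedD[OF Y])
    also have "\<dots> = (if i = k then 1 else 0)" using k sub_mat_fixedD[OF X, of i k] by simp
    finally show ?thesis .
  qed
qed

lemma sub_mat_fixed_transpose: "sub_mat R X = X \<Longrightarrow> sub_mat R (transpose X) = transpose X"
  unfolding sub_mat_fixed_iff transpose_def by auto

text \<open>Off \<open>R\<close> the rows and columns of \<open>X\<close> are unit vectors. A row of
  \<open>X ** Y\<close> there is the row of \<open>Y\<close>, and a column of \<open>Y ** X\<close>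
  is the column of \<open>Y\<close>; both products are the identity.\<close>

lemma sub_mat_fixed_inverse:
  assumes X: "sub_mat R X = X" and XY: "X ** Y = mat 1" and YX: "Y ** X = mat 1"
  shows "sub_mat R Y = Y"
  unfolding sub_mat_fixed_iff
proof (intro allI impI)
  fix i k assume ik: "i \<notin> R \<or> k \<notin> R"
  show "Y $ i $ k = (if i = k then 1 else 0)"
  proof (cases "i \<in> R")
    case False
    then have "(X ** Y) $ i $ k = (\<Sum>l\<in>UNIV. (if i = l then Y $ l $ k else 0))"
      by (simp only: matrix_matrix_mult_def vec_lambda_beta, intro sum.cong refl)
        (simp add: sub_mat_fixedD[OF X])
    then show ?thesis by (simp add: XY mat_def)
  next
    case True
    with ik have k: "k \<notin> R" by simp
    then have "(Y ** X) $ i $ k = (\<Sum>l\<in>UNIV. (if l = k then Y $ i $ l else 0))"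
      by (simp only: matrix_matrix_mult_def vec_lambda_beta, intro sum.cong refl)
        (simp add: sub_mat_fixedD[OF X])
    then show ?thesis by (simp add: YX mat_def)
  qed
qed

lemma matrix_inv_eqI:
  fixes X Y :: "real^'n^'n"
  assumes "X ** Y = mat 1"
  shows "matrix_inv X = Y"
proof -
  have "Y ** X = mat 1" using assms matrix_left_right_inverse by blast
  with assms have "X ** matrix_inv X = mat 1"
    unfolding matrix_inv_def by (rule_tac someI2) auto
  then have "Y ** (X ** matrix_inv X) = Y" by simp
  with \<open>Y ** X = mat 1\<close> show ?thesis by (simp add: matrix_mul_assoc)
qed

section \<open>Normal laws as products of residual densities\<close>

text \<open>With \<open>M\<close> the completed block of \<open>mat 1 - A\<close>, the precision
  matrix is \<open>transpose M ** D' ** M\<close>, so the quadratic form in the exponent is the sum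
  of squared residuals weighted by inverse variances. Since \<open>det M = 1\<close>, the
  determinant of the covariance is the product of the variances.\<close>

lemma mv_normal_linear_model:
  fixes A :: "real^'p::finite^'p" and s :: "'p \<Rightarrow> real" and c :: "real^'p"
  assumes G: "acyclic G" and A: "\<And>i k. A $ i $ k \<noteq> 0 \<Longrightarrow> (k, i) \<in> G"
    and s: "\<And>i. 0 < s i" and c: "\<And>i. i \<notin> R \<Longrightarrow> c $ i = 0"
  defines "B \<equiv> matrix_inv (sub_mat R (mat 1 - A))"
  shows "mv_normal R (B *v c)
      (B ** sub_mat R (\<chi> j k. if j = k then s j else 0) ** transpose B)
    = density (PiM R (\<lambda>_. lborel)) (\<lambda>x. ennreal
        (\<Prod>i\<in>R. normal_density 0 (sqrt (s i)) (x i - (\<Sum>k\<in>R. A $ i $ k * x k) - c $ i)))"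
proof -
  define M where "M = sub_mat R (mat 1 - A)"
  define D where "D = sub_mat R (\<chi> j k. if j = k then s j else 0)"
  \<comment> \<open>\<open>D\<close> and \<open>D'\<close> both carry an identity block off
    \<open>R\<close>; \<open>D'\<close> will invert \<open>D\<close>, and then \<open>W\<close>
    inverts \<open>V\<close>.\<close>
  define D' :: "real^'p^'p" where "D' = (\<chi> j k. if j = k then (if j \<in> R then 1 / s j else 1) else 0)"
  define V where "V = B ** D ** transpose B"
  define W where "W = transpose M ** D' ** M"
  have A0: "A $ i $ i = 0" for i
    using A[of i i] G by (auto simp: acyclic_def)
  have detM: "det M = 1"
  proof (rule det_unipotent_acyclic[OF G])
    show "M $ i $ i = 1" for i by (simp add: M_def sub_mat_def A0 mat_def)
    show "M $ i $ k \<noteq> 0 \<Longrightarrow> (k, i) \<in> G" if "i \<noteq> k" for i k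
      using that A[of i k] by (auto simp: M_def sub_mat_def mat_def split: if_splits)
  qed
  then have "invertible M" by (simp add: invertible_det_nz)
  then obtain N where N: "M ** N = mat 1" "N ** M = mat 1"
    unfolding invertible_def by blast
  have B: "B = N" unfolding B_def M_def[symmetric] by (rule matrix_inv_eqI[OF N(1)])
  have MB: "M ** B = mat 1" "B ** M = mat 1" using N B by simp_all
  have fM: "sub_mat R M = M" unfolding M_def by (rule sub_mat_idem)
  have fD: "sub_mat R D = D" unfolding D_def by (rule sub_mat_idem)
  have fB: "sub_mat R B = B" by (rule sub_mat_fixed_inverse[OF fM MB])
  have fV: "sub_mat R V = V"
    unfolding V_def by (intro sub_mat_fixed_mult sub_mat_fixed_transpose fB fD)
  have DD: "D ** D' = mat 1"
    unfolding vec_eq_iff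
  proof (intro allI)
    fix i k
    have "(D ** D') $ i $ k = (\<Sum>l\<in>UNIV. if i = l then D $ i $ i * D' $ i $ k else 0)"
      
      by (simp only: matrix_matrix_mult_def vec_lambda_beta, intro sum.cong refl)
        (simp add: D_def sub_mat_def)
    also have "\<dots> = mat 1 $ i $ k" using s[of i] by (auto simp: D_def D'_def sub_mat_def mat_def)
    finally show "(D ** D') $ i $ k = mat 1 $ i $ k" .
  qed
  have "V ** W = B ** (D ** ((transpose B ** transpose M) ** D')) ** M"
    unfolding V_def W_def by (simp add: matrix_mul_assoc)
  also have "transpose B ** transpose M = mat 1"
    by (simp flip: matrix_transpose_mul add: MB)
  finally have "V ** W = mat 1" by (simp add: DD MB)
  then have invV: "matrix_inv V = W" by (rule matrix_inv_eqI)
  have "det B = 1" using arg_cong[OF MB(1), of det] by (simp add: det_mul detM)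
  moreover have "det D = (\<Prod>i\<in>UNIV. if i \<in> R then s i else 1)"
    by (subst det_diagonal) (auto simp: D_def sub_mat_def intro!: prod.cong)
  ultimately have detV: "det V = (\<Prod>i\<in>R. s i)"
    unfolding V_def by (simp add: det_mul prod.If_cases)
  \<comment> \<open>The mean vanishes off \<open>R\<close>, so the centred vector extends by zero
    and sums over \<open>R\<close> can be read as full matrix products.\<close>
  have Bc: "(B *v c) $ i = 0" if "i \<notin> R" for i
  proof -
    have "(B *v c) $ i = (\<Sum>k\<in>UNIV. if i = k then c $ i else 0)"
      using that
      by (simp only: matrix_vector_mult_def vec_lambda_beta, intro sum.cong refl)
        (simp add: sub_mat_fixedD[OF fB])
    then show ?thesis using c[OF that] by simp
  qed
  have quad: "(\<Sum>i\<in>R. \<Sum>k\<in>R. (x i - (B *v c) $ i) * W $ i $ k * (x k - (B *v c) $ k))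
      = (\<Sum>i\<in>R. (x i - (\<Sum>k\<in>R. A $ i $ k * x k) - c $ i)\<^sup>2 / s i)" for x
  proof -
    \<comment> \<open>\<open>d\<close> is the centred observation, zero off \<open>R\<close>. Its
      image \<open>w\<close> under \<open>M\<close> is the residual vector on \<open>R\<close> and
      zero elsewhere, which turns the form in \<open>W\<close> into a diagonal one.\<close>
    define y :: "real^'p" where "y = (\<chi> i. if i \<in> R then x i else 0)"
    define d where "d = y - B *v c"
    define w where "w = M *v d"
    have d0: "d $ i = 0" if "i \<notin> R" for i using Bc[OF that] that by (simp add: d_def y_def)
    have d1: "d $ i = x i - (B *v c) $ i" if "i \<in> R" for i using that by (simp add: d_def y_def)
    have "w = M *v y - M *v (B *v c)" by (simp add: w_def d_def matrix_vector_mult_diff_distrib)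
    then have w: "w = M *v y - c" by (simp add: matrix_vector_mul_assoc MB)
    have w0: "w $ i = 0" if "i \<notin> R" for i
    proof -
      have "w $ i = (\<Sum>k\<in>UNIV. if i = k then d $ i else 0)"
        using that
        by (simp only: w_def matrix_vector_mult_def vec_lambda_beta, intro sum.cong refl)
          (simp add: sub_mat_fixedD[OF fM])
      then show ?thesis using d0[OF that] by simp
    qed
    have w1: "w $ i = x i - (\<Sum>k\<in>R. A $ i $ k * x k) - c $ i" if "i \<in> R" for i
    proof -
      have "(M *v y) $ i = (\<Sum>k\<in>UNIV. if k \<in> R then (if i = k then x i else 0) - A $ i $ k * x k else 0)"
        using that
        by (simp only: matrix_vector_mult_def vec_lambda_beta, intro sum.cong refl)
          (simp add: M_def sub_mat_def y_def mat_def algebra_simps)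
      also have "\<dots> = (\<Sum>k\<in>R. (if i = k then x i else 0) - A $ i $ k * x k)"
        by (simp add: sum.If_cases)
      also have "\<dots> = x i - (\<Sum>k\<in>R. A $ i $ k * x k)"
        using that by (simp add: sum_subtractf)
      finally show ?thesis by (simp add: w)
    qed
    have "(\<Sum>i\<in>R. \<Sum>k\<in>R. (x i - (B *v c) $ i) * W $ i $ k * (x k - (B *v c) $ k))
        = (\<Sum>i\<in>R. \<Sum>k\<in>R. d $ i * W $ i $ k * d $ k)"
      by (intro sum.cong refl) (simp add: d1)
    also have "\<dots> = (\<Sum>i\<in>UNIV. \<Sum>k\<in>UNIV. d $ i * W $ i $ k * d $ k)"
      by (intro sum.mono_neutral_cong_left ballI) (auto simp: d0)
    also have "\<dots> = d \<bullet> (W *v d)"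
      by (simp add: inner_vec_def matrix_vector_mult_def sum_distrib_left mult.assoc)
    also have "W *v d = transpose M *v (D' *v w)"
      by (simp add: W_def w_def matrix_vector_mul_assoc matrix_mul_assoc)
    also have "d \<bullet> (transpose M *v (D' *v w)) = w \<bullet> (D' *v w)"
      using dot_lmul_matrix[of "D' *v w" M d] by (simp add: w_def inner_commute)
    also have "\<dots> = (\<Sum>i\<in>UNIV. w $ i * (\<Sum>k\<in>UNIV. if i = k then (if i \<in> R then 1 / s i else 1) * w $ i else 0))"
      by (simp only: inner_vec_def matrix_vector_mult_def vec_lambda_beta inner_real_def,
          intro sum.cong refl arg_cong2[where f="(*)"])
        (simp add: D'_def)
    also have "\<dots> = (\<Sum>i\<in>R. (w $ i)\<^sup>2 / s i)"
      by (simp add: power2_eq_square w0 sum.mono_neutral_cong_right[of UNIV R])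
    also have "\<dots> = (\<Sum>i\<in>R. (x i - (\<Sum>k\<in>R. A $ i $ k * x k) - c $ i)\<^sup>2 / s i)"
      by (intro sum.cong) (auto simp: w1)
    finally show ?thesis .
  qed
  have "exp (- (\<Sum>i\<in>R. (z i)\<^sup>2 / s i) / 2) / sqrt ((2 * pi) ^ card R * (\<Prod>i\<in>R. s i))
      = (\<Prod>i\<in>R. normal_density 0 (sqrt (s i)) (z i))" for z
  proof -
    have "(\<Prod>i\<in>R. normal_density 0 (sqrt (s i)) (z i))
      = (\<Prod>i\<in>R. exp (- ((z i)\<^sup>2 / s i) / 2) / sqrt (2 * pi * s i))"
      using s by (intro prod.cong) (auto simp: normal_density_def less_imp_le)
    also have "\<dots> = exp (\<Sum>i\<in>R. - ((z i)\<^sup>2 / s i) / 2) / (\<Prod>i\<in>R. sqrt (2 * pi * s i))"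
      by (simp add: prod_dividef exp_sum)
    also have "(\<Prod>i\<in>R. sqrt (2 * pi * s i)) = sqrt (\<Prod>i\<in>R. 2 * pi * s i)"
      by (induction R rule: infinite_finite_induct) (simp_all add: real_sqrt_mult)
    also have "(\<Prod>i\<in>R. 2 * pi * s i) = (2 * pi) ^ card R * (\<Prod>i\<in>R. s i)"
      by (simp add: prod.distrib)
    also have "(\<Sum>i\<in>R. - ((z i)\<^sup>2 / s i) / 2) = - (\<Sum>i\<in>R. (z i)\<^sup>2 / s i) / 2"
      by (simp add: sum_divide_distrib sum_negf)
    finally show ?thesis by simp
  qed
  then show ?thesis
    unfolding mv_normal_def V_def[symmetric] D_def[symmetric] fV invV detV quad by simp
qed

text \<open>These are the consequences of membership in \<open>Theta\<close> that do not refer to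
  the setting; the laws and their divergences are computed from them. The last equation says that
  the noise covariance is diagonal.\<close>

definition regular_sem :: "'p::finite sem \<Rightarrow> bool" where
  "regular_sem \<theta> \<longleftrightarrow> acyclic (graph \<theta>) \<and>
     (\<forall>i k. coef \<theta> $ i $ k \<noteq> 0 \<longrightarrow> (k, i) \<in> graph \<theta>) \<and>
     (\<forall>i. 0 < ncov \<theta> $ i $ i) \<and>
     ncov \<theta> = (\<chi> j k. if j = k then ncov \<theta> $ j $ j else 0)"

lemma Theta_regular:
  assumes "valid_setting S" "\<theta> \<in> Theta S"
  shows "regular_sem \<theta>"
proof -
  from assms(2) obtain \<sigma> where \<sigma>:
      "ncov \<theta> = (\<chi> j k. if j = k then (\<sigma> j)\<^sup>2 else 0)"
      "\<And>j. (sigma_min S)\<^sup>2 \<le> (\<sigma> j)\<^sup>2"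
    unfolding Theta_def by blast
  have "0 < (\<sigma> j)\<^sup>2" for j
    using \<sigma>(2)[of j] assms(1) by (smt (verit) valid_setting_def zero_less_power)
  then have "0 < ncov \<theta> $ j $ j" for j
    unfolding \<sigma>(1) by simp
  moreover have "ncov \<theta> = (\<chi> j k. if j = k then ncov \<theta> $ j $ j else 0)"
    unfolding \<sigma>(1) by (simp add: vec_eq_iff)
  ultimately show ?thesis
    using assms(2) unfolding regular_sem_def Theta_def by blast
qed

text \<open>This is the index set \<open>R\<close> of the non-degenerate coordinates of the
  law.\<close>

definition active :: "'p action \<Rightarrow> 'p set" where
  "active a = {i. fst a \<noteq> Some i}"

text \<open>
  Residuals are taken of the full vector, with the intervened coordinate filled in, so that
  \<open>sem_density \<theta> a X\<close> is jointly measurable in the action and the observation although the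
  dimension of the law depends on the action.
\<close>

definition resid :: "'p::finite sem \<Rightarrow> real^'p \<Rightarrow> 'p \<Rightarrow> real" where
  "resid \<theta> X i = X $ i - (\<Sum>k\<in>UNIV. coef \<theta> $ i $ k * X $ k)"

definition sem_density :: "'p::finite sem \<Rightarrow> 'p action \<Rightarrow> real^'p \<Rightarrow> real" where
  "sem_density \<theta> a X = (\<Prod>i\<in>active a. normal_density 0 (sqrt (ncov \<theta> $ i $ i)) (resid \<theta> X i))"

text \<open>The fixed value of the target node acts on its children as a constant shift: this is the
  vector \<open>A_{R,j} u\<close> in the mean of the interventional law.\<close>

definition intercept :: "'p::finite sem \<Rightarrow> 'p action \<Rightarrow> 'p \<Rightarrow> real" where
  "intercept \<theta> a i = (case fst a of None \<Rightarrow> 0 | Some j \<Rightarrow> coef \<theta> $ i $ j * snd a)"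

text \<open>Splitting the target node off the sum over parents leaves a residual on
  \<open>active a\<close> shifted by a constant, the shape that the elimination of sinks can
  integrate.\<close>

lemma resid_full_vec:
  assumes "i \<in> active a"
  shows "resid \<theta> (full_vec a x) i
    = x i - (\<Sum>k\<in>active a. coef \<theta> $ i $ k * x k) - intercept \<theta> a i"
proof (cases "fst a")
  case None
  then show ?thesis by (simp add: resid_def full_vec_def active_def intercept_def)
next
  case (Some j)
  have R: "UNIV = insert j (active a)" "j \<notin> active a" "finite (active a)"
    using Some by (auto simp: active_def)
  have "(\<Sum>k\<in>UNIV. coef \<theta> $ i $ k * full_vec a x $ k)
      = coef \<theta> $ i $ j * snd a + (\<Sum>k\<in>active a. coef \<theta> $ i $ k * full_vec a x $ k)"
    unfolding R(1) using R(2,3) Some by (simp add: full_vec_def)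
  also have "(\<Sum>k\<in>active a. coef \<theta> $ i $ k * full_vec a x $ k)
      = (\<Sum>k\<in>active a. coef \<theta> $ i $ k * x k)"
    by (intro sum.cong) (auto simp: full_vec_def active_def)
  finally show ?thesis
    using assms Some by (simp add: resid_def full_vec_def active_def intercept_def)
qed

text \<open>Passive observation is the case \<open>active a = UNIV\<close> with zero intercept, so
  one linear model with a shift covers both definitions of the law.\<close>

lemma law_eq_density:
  fixes \<theta> :: "'p::finite sem"
  assumes "regular_sem \<theta>"
  shows "law \<theta> a = density (PiM (active a) (\<lambda>_. lborel)) (\<lambda>x. ennreal (sem_density \<theta> a (full_vec a x)))"
proof -
  have G: "acyclic (graph \<theta>)" "\<And>i k. coef \<theta> $ i $ k \<noteq> 0 \<Longrightarrow> (k, i) \<in> graph \<theta>"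
      "\<And>i. 0 < ncov \<theta> $ i $ i"
    and ncov: "(\<chi> j k. if j = k then ncov \<theta> $ j $ j else 0) = ncov \<theta>"
    using assms by (auto simp: regular_sem_def)
  let ?R = "active a"
  let ?c = "\<chi> i. if i \<in> ?R then intercept \<theta> a i else 0"
  let ?B = "matrix_inv (sub_mat ?R (mat 1 - coef \<theta>))"
  have "law \<theta> a = mv_normal ?R (?B *v ?c) (?B ** sub_mat ?R (ncov \<theta>) ** transpose ?B)"
  proof (cases "fst a")
    case None
    then have "?R = UNIV" "?c = 0" by (auto simp: active_def intercept_def vec_eq_iff)
    moreover have "sub_mat UNIV X = X" for X :: "real^'p^'p" by (simp add: sub_mat_def vec_eq_iff)
    ultimately show ?thesis
      using None by (cases a) (simp add: law_def obs_law_def Let_def)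
  next
    case (Some j)
    then obtain u where a: "a = (Some j, u)" by (cases a) auto
    then have "?R = UNIV - {j}" by (auto simp: active_def)
    moreover have "?c = (\<chi> i. if i \<in> UNIV - {j} then coef \<theta> $ i $ j * u else 0)"
      using a by (auto simp: intercept_def vec_eq_iff active_def)
    ultimately show ?thesis
      unfolding a by (simp add: law_def do_law_def Let_def)
  qed
  also have "\<dots> = density (PiM ?R (\<lambda>_. lborel)) (\<lambda>x. ennreal
        (\<Prod>i\<in>?R. normal_density 0 (sqrt (ncov \<theta> $ i $ i))
           (x i - (\<Sum>k\<in>?R. coef \<theta> $ i $ k * x k) - ?c $ i)))"
    using mv_normal_linear_model[where A="coef \<theta>" and s="\<lambda>i. ncov \<theta> $ i $ i", OF G, where R="?R" and c="?c"] by (simp add: ncov)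
  also have "\<dots> = density (PiM ?R (\<lambda>_. lborel)) (\<lambda>x. ennreal (sem_density \<theta> a (full_vec a x)))"
    unfolding sem_density_def by (simp add: resid_full_vec)
  finally show ?thesis .
qed

lemma measurable_vec_nth [measurable]: "(\<lambda>X::real^'n. X $ i) \<in> borel_measurable borel"
  by (intro borel_measurable_continuous_onI continuous_intros)

lemma measurable_vecI:
  fixes f :: "'a \<Rightarrow> real^'n"
  assumes "\<And>i. (\<lambda>x. f x $ i) \<in> borel_measurable M"
  shows "f \<in> borel_measurable M"
  unfolding borel_measurable_euclidean_space[of f]
  using assms by (auto simp: Basis_vec_def inner_axis)

lemma measurable_full_vec [measurable]:
  "full_vec a \<in> PiM (active a) (\<lambda>_. lborel) \<rightarrow>\<^sub>M borel"
proof (rule measurable_vecI)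
  fix i show "(\<lambda>x. full_vec a x $ i) \<in> borel_measurable (PiM (active a) (\<lambda>_. lborel))"
  proof (cases "i \<in> active a")
    case True
    then show ?thesis
      using measurable_component_singleton[OF True, of "\<lambda>_. lborel :: real measure"]
      by (simp add: full_vec_def active_def)
  qed (simp add: full_vec_def active_def)
qed

lemma measurable_resid [measurable]: "(\<lambda>X. resid \<theta> X i) \<in> borel_measurable borel"
  unfolding resid_def by measurable

lemma measurable_sem_density [measurable]: "sem_density \<theta> a \<in> borel_measurable borel"
  unfolding sem_density_def by measurable

lemma sem_density_pos: "regular_sem \<theta> \<Longrightarrow> 0 < sem_density \<theta> a X"
  unfolding sem_density_def regular_sem_def by (intro prod_pos ballI normal_density_pos) auto

lemma nn_integral_sample_law:
  assumes "regular_sem \<theta>" and [measurable]: "f \<in> borel_measurable borel"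
  shows "(\<integral>\<^sup>+X. f X \<partial>sample_law \<theta> a) = (\<integral>\<^sup>+x. ennreal (sem_density \<theta> a (full_vec a x)) * f (full_vec a x)
      \<partial>PiM (active a) (\<lambda>_. lborel))"
proof -
  have [measurable]: "full_vec a \<in> law \<theta> a \<rightarrow>\<^sub>M borel"
    unfolding law_eq_density[OF assms(1)] by simp
  have "(\<integral>\<^sup>+X. f X \<partial>sample_law \<theta> a) = (\<integral>\<^sup>+x. f (full_vec a x) \<partial>law \<theta> a)"
    unfolding sample_law_def by (rule nn_integral_distr) measurable
  then show ?thesis
    unfolding law_eq_density[OF assms(1)] by (simp add: nn_integral_density)
qed

lemma nn_integral_resid:
  assumes "regular_sem \<theta>" and [measurable]: "\<And>i. g i \<in> borel_measurable borel"
  shows "(\<integral>\<^sup>+x. (\<Prod>i\<in>active a. g i (resid \<theta> (full_vec a x) i)) \<partial>PiM (active a) (\<lambda>_. lborel))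
    = (\<Prod>i\<in>active a. \<integral>\<^sup>+y. g i y \<partial>lborel)"
proof -
  have "(\<integral>\<^sup>+x. (\<Prod>i\<in>active a. g i (resid \<theta> (full_vec a x) i)) \<partial>PiM (active a) (\<lambda>_. lborel))
    = (\<integral>\<^sup>+x. (\<Prod>i\<in>active a. g i (x i - (\<Sum>k\<in>active a. coef \<theta> $ i $ k * x k) - intercept \<theta> a i))
        \<partial>PiM (active a) (\<lambda>_. lborel))"
    by (simp add: resid_full_vec)
  also have "\<dots> = (\<Prod>i\<in>active a. \<integral>\<^sup>+y. g i y \<partial>lborel)"
    using assms(1) by (intro nn_integral_acyclic_residuals[where G="graph \<theta>"]) (auto simp: regular_sem_def)
  finally show ?thesis .
qed

lemma nn_integral_normal_density: "0 < \<sigma> \<Longrightarrow> (\<integral>\<^sup>+y. ennreal (normal_density \<mu> \<sigma> y) \<partial>lborel) = 1"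
  by (subst nn_integral_eq_integral) auto

lemma nn_integral_sem_density:
  assumes "regular_sem \<theta>"
  shows "(\<integral>\<^sup>+x. ennreal (sem_density \<theta> a (full_vec a x)) \<partial>PiM (active a) (\<lambda>_. lborel)) = 1"
proof -
  have "(\<integral>\<^sup>+x. ennreal (sem_density \<theta> a (full_vec a x)) \<partial>PiM (active a) (\<lambda>_. lborel))
    = (\<integral>\<^sup>+x. (\<Prod>i\<in>active a. ennreal (normal_density 0 (sqrt (ncov \<theta> $ i $ i)) (resid \<theta> (full_vec a x) i)))
        \<partial>PiM (active a) (\<lambda>_. lborel))"
    unfolding sem_density_def by (simp add: prod_ennreal)
  also have "\<dots> = (\<Prod>i\<in>active a. \<integral>\<^sup>+y. ennreal (normal_density 0 (sqrt (ncov \<theta> $ i $ i)) y) \<partial>lborel)"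
    by (rule nn_integral_resid[OF assms]) simp
  also have "\<dots> = 1"
    using assms by (intro prod.neutral ballI nn_integral_normal_density) (auto simp: regular_sem_def)
  finally show ?thesis .
qed

lemma sets_sample_law [measurable_cong]: "sets (sample_law \<theta> a) = sets borel"
  by (simp add: sample_law_def)

lemma space_sample_law [simp]: "space (sample_law \<theta> a) = UNIV"
  by (simp add: sample_law_def)

lemma prob_space_sample_law: "regular_sem \<theta> \<Longrightarrow> prob_space (sample_law \<theta> a)"
  using nn_integral_sample_law[of \<theta> "\<lambda>_. 1" a] nn_integral_sem_density[of \<theta> a]
  by (intro prob_spaceI) simp

section \<open>The log-likelihood ratio and the divergence of one action\<close>

definition log_ratio :: "'p::finite sem \<Rightarrow> 'p sem \<Rightarrow> 'p action \<Rightarrow> real^'p \<Rightarrow> real" where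
  "log_ratio \<theta> \<eta> a X = ln (sem_density \<theta> a X / sem_density \<eta> a X)"

lemma measurable_log_ratio [measurable]: "log_ratio \<theta> \<eta> a \<in> borel_measurable borel"
  unfolding log_ratio_def by measurable

text \<open>The reference measure and the map \<open>full_vec a\<close> depend on the action only,
  hence are common to both models. Positivity of the densities makes their ratio defined
  everywhere.\<close>

lemma sample_law_density:
  assumes \<theta>: "regular_sem \<theta>" and \<eta>: "regular_sem \<eta>"
  shows "sample_law \<eta> a = density (sample_law \<theta> a) (\<lambda>X. ennreal (exp (- log_ratio \<theta> \<eta> a X)))"
proof (rule measure_eqI)
  fix A assume "A \<in> sets (sample_law \<eta> a)"
  then have A[measurable]: "A \<in> sets borel" by (simp add: sets_sample_law)
  have "emeasure (sample_law \<eta> a) A = (\<integral>\<^sup>+X. indicator A X \<partial>sample_law \<eta> a)"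
    by (simp add: sets_sample_law)
  also have "\<dots> = (\<integral>\<^sup>+x. ennreal (sem_density \<theta> a (full_vec a x))
      * (ennreal (exp (- log_ratio \<theta> \<eta> a (full_vec a x))) * indicator A (full_vec a x)) \<partial>PiM (active a) (\<lambda>_. lborel))"
    unfolding nn_integral_sample_law[OF \<eta> borel_measurable_indicator[OF A]]
  proof (intro nn_integral_cong)
    fix x
    have "sem_density \<eta> a (full_vec a x)
        = sem_density \<theta> a (full_vec a x) * exp (- log_ratio \<theta> \<eta> a (full_vec a x))"
      using sem_density_pos[OF \<theta>, of a "full_vec a x"] sem_density_pos[OF \<eta>, of a "full_vec a x"]
      by (simp add: log_ratio_def exp_minus)
    then show "ennreal (sem_density \<eta> a (full_vec a x)) * indicator A (full_vec a x)
        = ennreal (sem_density \<theta> a (full_vec a x))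
      * (ennreal (exp (- log_ratio \<theta> \<eta> a (full_vec a x))) * indicator A (full_vec a x))"
      using sem_density_pos[OF \<theta>, of a "full_vec a x"]
      by (simp add: ennreal_mult flip: mult.assoc)
  qed
  also have "\<dots> = (\<integral>\<^sup>+X. ennreal (exp (- log_ratio \<theta> \<eta> a X)) * indicator A X \<partial>sample_law \<theta> a)"
    by (rule nn_integral_sample_law[OF \<theta>, symmetric]) measurable
  also have "\<dots> = emeasure (density (sample_law \<theta> a) (\<lambda>X. ennreal (exp (- log_ratio \<theta> \<eta> a X)))) A"
    by (subst emeasure_density) (auto simp: sets_sample_law)
  finally show "emeasure (sample_law \<eta> a) A
      = emeasure (density (sample_law \<theta> a) (\<lambda>X. ennreal (exp (- log_ratio \<theta> \<eta> a X)))) A" .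
qed (simp add: sets_sample_law)

lemma integrable_square_add:
  fixes f g :: "'a \<Rightarrow> real"
  assumes [measurable]: "f \<in> borel_measurable M" "g \<in> borel_measurable M"
    and "integrable M (\<lambda>x. (f x)\<^sup>2)" "integrable M (\<lambda>x. (g x)\<^sup>2)"
  shows "integrable M (\<lambda>x. (f x + g x)\<^sup>2)"
proof (rule Bochner_Integration.integrable_bound)
  show "integrable M (\<lambda>x. 2 * (f x)\<^sup>2 + 2 * (g x)\<^sup>2)" using assms by simp
  have "(a + b)\<^sup>2 \<le> 2 * a\<^sup>2 + 2 * b\<^sup>2" for a b :: real
    using sum_squares_ge_zero[of "a - b" 0] by (simp add: power2_eq_square algebra_simps)
  then show "AE x in M. norm ((f x + g x)\<^sup>2) \<le> norm (2 * (f x)\<^sup>2 + 2 * (g x)\<^sup>2)"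
    by auto
qed measurable

lemma integrable_square_sum:
  fixes f :: "'i \<Rightarrow> 'a \<Rightarrow> real"
  assumes "\<And>i. i \<in> I \<Longrightarrow> f i \<in> borel_measurable M" "\<And>i. i \<in> I \<Longrightarrow> integrable M (\<lambda>x. (f i x)\<^sup>2)"
  shows "integrable M (\<lambda>x. (\<Sum>i\<in>I. f i x)\<^sup>2)"
  using assms
proof (induction I rule: infinite_finite_induct)
  case (insert i I)
  then show ?case by (simp add: integrable_square_add)
qed simp_all

text \<open>The elimination of sinks is applied with the density of residual \<open>i\<close>
  weighted by its square; the result is a product of total masses and one second moment of a normal
  law.\<close>

lemma integrable_resid_square:
  assumes \<theta>: "regular_sem \<theta>" and i: "i \<in> active a"
  shows "integrable (sample_law \<theta> a) (\<lambda>X. (resid \<theta> X i)\<^sup>2)"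
proof (rule integrableI_nonneg)
  let ?n = "\<lambda>k. normal_density 0 (sqrt (ncov \<theta> $ k $ k))"
  define g where "g k y = (if k = i then ennreal (?n k y * (y - 0) ^ 2) else ennreal (?n k y))" for k y
  have [measurable]: "g k \<in> borel_measurable borel" for k unfolding g_def by simp
  have v: "0 < sqrt (ncov \<theta> $ k $ k)" for k using \<theta> by (simp add: regular_sem_def)
  have fin: "(\<integral>\<^sup>+y. g k y \<partial>lborel) \<noteq> \<top>" for k
  proof (cases "k = i")
    case True
    have "integrable lborel (\<lambda>y. ?n k y * (y - 0) ^ 2)"
      by (rule integrable_normal_moment[OF v])
    then show ?thesis
      using True by (subst nn_integral_cong[where v="\<lambda>y. ennreal (?n k y * (y - 0) ^ 2)"])
        (auto simp: g_def nn_integral_eq_integral)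
  next
    case False
    then show ?thesis unfolding g_def by (simp add: nn_integral_normal_density[OF v])
  qed
  have "(\<integral>\<^sup>+X. ennreal ((resid \<theta> X i)\<^sup>2) \<partial>sample_law \<theta> a)
      = (\<integral>\<^sup>+x. (\<Prod>k\<in>active a. g k (resid \<theta> (full_vec a x) k)) \<partial>PiM (active a) (\<lambda>_. lborel))"
    unfolding nn_integral_sample_law[OF \<theta>, of "\<lambda>X. ennreal ((resid \<theta> X i)\<^sup>2)", simplified]
  proof (intro nn_integral_cong)
    fix x
    let ?r = "resid \<theta> (full_vec a x)"
    have "(\<Prod>k\<in>active a. g k (?r k)) = g i (?r i) * (\<Prod>k\<in>active a - {i}. g k (?r k))"
      using i by (intro prod.remove) auto
    also have "(\<Prod>k\<in>active a - {i}. g k (?r k)) = (\<Prod>k\<in>active a - {i}. ennreal (?n k (?r k)))"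
      by (intro prod.cong) (auto simp: g_def)
    also have "g i (?r i) = ennreal ((?r i)\<^sup>2) * ennreal (?n i (?r i))"
      by (simp add: g_def ennreal_mult mult.commute)
    also have "\<dots> * (\<Prod>k\<in>active a - {i}. ennreal (?n k (?r k)))
        = ennreal ((?r i)\<^sup>2) * (\<Prod>k\<in>active a. ennreal (?n k (?r k)))"
      using i by (simp add: prod.remove[of "active a" i] mult.assoc)
    also have "\<dots> = ennreal (sem_density \<theta> a (full_vec a x)) * ennreal ((?r i)\<^sup>2)"
      by (simp add: sem_density_def prod_ennreal mult.commute)
    finally show "ennreal (sem_density \<theta> a (full_vec a x)) * ennreal ((?r i)\<^sup>2)
        = (\<Prod>k\<in>active a. g k (?r k))" by simp
  qed
  also have "\<dots> = (\<Prod>k\<in>active a. \<integral>\<^sup>+y. g k y \<partial>lborel)"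
    by (rule nn_integral_resid[OF \<theta>]) simp
  also have "\<dots> < \<infinity>" using fin by (simp add: ennreal_prod_eq_top less_top[symmetric])
  finally show "(\<integral>\<^sup>+X. ennreal ((resid \<theta> X i)\<^sup>2) \<partial>sample_law \<theta> a) < \<infinity>" .
qed simp_all

text \<open>Induction along the graph: a coordinate is its own residual plus a combination of its
  parents, and finite sums preserve square integrability. The target of an intervention is almost
  surely constant.\<close>

lemma integrable_coordinate_square:
  assumes \<theta>: "regular_sem \<theta>"
  shows "integrable (sample_law \<theta> a) (\<lambda>X. (X $ i)\<^sup>2)"
proof -
  interpret prob_space "sample_law \<theta> a" by (rule prob_space_sample_law[OF \<theta>])
  have wf: "wf (graph \<theta>)"
    using \<theta> by (intro finite_acyclic_wf) (auto simp: regular_sem_def)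
  show ?thesis
  proof (induction i rule: wf_induct_rule[OF wf])
    case (1 i)
    show ?case
    proof (cases "i \<in> active a")
      case True
      have "integrable (sample_law \<theta> a) (\<lambda>X. (coef \<theta> $ i $ k * X $ k)\<^sup>2)" for k
        using 1[of k] \<theta> by (cases "coef \<theta> $ i $ k = 0") (auto simp: power_mult_distrib regular_sem_def)
      then have "integrable (sample_law \<theta> a) (\<lambda>X. (resid \<theta> X i + (\<Sum>k\<in>UNIV. coef \<theta> $ i $ k * X $ k))\<^sup>2)"
        by (intro integrable_square_add integrable_square_sum integrable_resid_square[OF \<theta> True]) auto
      then show ?thesis by (simp add: resid_def)
    next
      case False
      have [measurable]: "full_vec a \<in> law \<theta> a \<rightarrow>\<^sub>M borel"
        unfolding law_eq_density[OF \<theta>] by simp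
      have "AE X in sample_law \<theta> a. X $ i = snd a"
        unfolding sample_law_def by (subst AE_distr_iff) (use False in \<open>auto simp: full_vec_def active_def\<close>)
      then have "AE X in sample_law \<theta> a. (snd a)\<^sup>2 = (X $ i)\<^sup>2" by auto
      then show ?thesis
        by (rule integrable_cong_AE[THEN iffD1, rotated 2]) simp_all
    qed
  qed
qed

text \<open>The log-likelihood of \<open>\<eta>\<close> under the law of \<open>\<theta>\<close>
  involves the residuals of a foreign model; these are still linear in the coordinates.\<close>

lemma integrable_resid_square':
  assumes \<theta>: "regular_sem \<theta>"
  shows "integrable (sample_law \<theta> a) (\<lambda>X. (resid \<eta> X i)\<^sup>2)"
proof -
  have "integrable (sample_law \<theta> a) (\<lambda>X. (X $ i + (\<Sum>k\<in>UNIV. - coef \<eta> $ i $ k * X $ k))\<^sup>2)"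
    using integrable_coordinate_square[OF \<theta>]
    by (intro integrable_square_add integrable_square_sum) (auto simp: power_mult_distrib)
  then show ?thesis by (simp add: resid_def sum_negf)
qed

lemma ln_sem_density:
  assumes "regular_sem \<theta>"
  shows "ln (sem_density \<theta> a X) = (\<Sum>i\<in>active a. ln (1 / sqrt (2 * pi * ncov \<theta> $ i $ i)) - (resid \<theta> X i)\<^sup>2 / (2 * ncov \<theta> $ i $ i))"
proof -
  have v: "0 < ncov \<theta> $ i $ i" for i using assms by (simp add: regular_sem_def)
  have "ln (sem_density \<theta> a X) = (\<Sum>i\<in>active a. ln (normal_density 0 (sqrt (ncov \<theta> $ i $ i)) (resid \<theta> X i)))"
    unfolding sem_density_def using v
    by (intro ln_prod less_imp_neq[THEN not_sym] normal_density_pos) auto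
  also have "\<dots> = (\<Sum>i\<in>active a. ln (1 / sqrt (2 * pi * ncov \<theta> $ i $ i)) - (resid \<theta> X i)\<^sup>2 / (2 * ncov \<theta> $ i $ i))"
    using v by (intro sum.cong) (auto simp: normal_density_def ln_mult less_imp_le ln_div)
  finally show ?thesis .
qed

lemma integrable_log_ratio:
  assumes \<theta>: "regular_sem \<theta>" and \<eta>: "regular_sem \<eta>"
  shows "integrable (sample_law \<theta> a) (log_ratio \<theta> \<eta> a)"
proof -
  interpret prob_space "sample_law \<theta> a" by (rule prob_space_sample_law[OF \<theta>])
  have "log_ratio \<theta> \<eta> a = (\<lambda>X. ln (sem_density \<theta> a X) - ln (sem_density \<eta> a X))"
    using sem_density_pos[OF \<theta>, THEN less_imp_neq, THEN not_sym]
      sem_density_pos[OF \<eta>, THEN less_imp_neq, THEN not_sym]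
    by (simp add: log_ratio_def ln_div fun_eq_iff)
  then show ?thesis
    unfolding ln_sem_density[OF \<theta>] ln_sem_density[OF \<eta>]
    by (simp only:) (intro Bochner_Integration.integrable_diff Bochner_Integration.integrable_sum
      integrable_divide integrable_const integrable_resid_square'[OF \<theta>])
qed

text \<open>Both laws have densities against one reference measure, so \<open>KL_divergence\<close>
  is an integral of the log ratio; \<open>full_vec a\<close> carries it over to the vector that the
  learner sees.\<close>

lemma KL_eq_integral:
  assumes \<theta>: "regular_sem \<theta>" and \<eta>: "regular_sem \<eta>"
  shows "KL (law \<theta> a) (law \<eta> a) = (\<integral>X. log_ratio \<theta> \<eta> a X \<partial>sample_law \<theta> a)"
proof -
  interpret L: product_sigma_finite "\<lambda>_::'a. lborel :: real measure" by unfold_locales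
  interpret F: sigma_finite_measure "PiM (active a) (\<lambda>_. lborel :: real measure)"
    by (rule L.sigma_finite) simp
  have [measurable]: "full_vec a \<in> law \<theta> a \<rightarrow>\<^sub>M borel"
    unfolding law_eq_density[OF \<theta>] by simp
  let ?p = "\<lambda>\<theta> x. sem_density \<theta> a (full_vec a x)"
  have "KL (law \<theta> a) (law \<eta> a)
      = (\<integral>x. ?p \<theta> x * log (exp 1) (?p \<theta> x / ?p \<eta> x) \<partial>PiM (active a) (\<lambda>_. lborel))"
    unfolding KL_def law_eq_density[OF \<theta>] law_eq_density[OF \<eta>]
  proof (rule F.KL_density_density)
    show "AE x in PiM (active a) (\<lambda>_. lborel). ?p \<eta> x = 0 \<longrightarrow> ?p \<theta> x = 0"
      using sem_density_pos[OF \<eta>] by (intro AE_I2) (metis less_irrefl)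
  qed (auto intro!: less_imp_le sem_density_pos \<theta> \<eta>)
  also have "\<dots> = (\<integral>x. ?p \<theta> x * log_ratio \<theta> \<eta> a (full_vec a x) \<partial>PiM (active a) (\<lambda>_. lborel))"
    by (simp add: log_ratio_def log_def)
  also have "\<dots> = (\<integral>x. log_ratio \<theta> \<eta> a (full_vec a x) \<partial>law \<theta> a)"
    unfolding law_eq_density[OF \<theta>]
    by (subst integral_real_density) (auto intro!: less_imp_le sem_density_pos \<theta>)
  also have "\<dots> = (\<integral>X. log_ratio \<theta> \<eta> a X \<partial>sample_law \<theta> a)"
    unfolding sample_law_def by (rule integral_distr[symmetric]) measurable
  finally show ?thesis .
qed

lemma nn_integral_exp_log_ratio:
  assumes \<theta>: "regular_sem \<theta>" and \<eta>: "regular_sem \<eta>"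
  shows "(\<integral>\<^sup>+X. ennreal (exp (- log_ratio \<theta> \<eta> a X)) \<partial>sample_law \<theta> a) = 1"
proof -
  interpret Q: prob_space "sample_law \<eta> a" by (rule prob_space_sample_law[OF \<eta>])
  show ?thesis
    using Q.emeasure_space_1 unfolding sample_law_density[OF \<theta> \<eta>]
    by (simp add: emeasure_density)
qed

text \<open>The bound \<open>1 - exp (- z) \<le> z\<close> is integrated, and
  \<open>exp (- z)\<close> has mean one, being the density of the other law. Hence
  \<open>ennreal\<close> truncates nothing in \<open>info_complexity\<close>.\<close>

lemma KL_nonneg:
  assumes \<theta>: "regular_sem \<theta>" and \<eta>: "regular_sem \<eta>"
  shows "0 \<le> KL (law \<theta> a) (law \<eta> a)"
proof -
  interpret prob_space "sample_law \<theta> a" by (rule prob_space_sample_law[OF \<theta>])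
  have int: "integrable (sample_law \<theta> a) (\<lambda>X. exp (- log_ratio \<theta> \<eta> a X))"
    by (rule integrableI_nonneg) (auto simp: nn_integral_exp_log_ratio[OF \<theta> \<eta>])
  have "(\<integral>X. exp (- log_ratio \<theta> \<eta> a X) \<partial>sample_law \<theta> a) = 1"
    by (subst integral_eq_nn_integral) (auto simp: nn_integral_exp_log_ratio[OF \<theta> \<eta>])
  then have "0 = (\<integral>X. 1 - exp (- log_ratio \<theta> \<eta> a X) \<partial>sample_law \<theta> a)"
    using int prob_space by simp
  also have "\<dots> \<le> (\<integral>X. log_ratio \<theta> \<eta> a X \<partial>sample_law \<theta> a)"
  proof (rule integral_mono)
    show "1 - exp (- log_ratio \<theta> \<eta> a X) \<le> log_ratio \<theta> \<eta> a X" for X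
      using exp_ge_add_one_self[of "- log_ratio \<theta> \<eta> a X"] by linarith
  qed (use int integrable_log_ratio[OF \<theta> \<eta>] in auto)
  finally show ?thesis by (simp add: KL_eq_integral[OF \<theta> \<eta>])
qed

text \<open>This is the mean of the log ratio with the negative part moved to the other side. In
  this form it can be integrated over actions and histories before integrability there is
  known.\<close>

lemma nn_integral_pos_log_ratio:
  assumes \<theta>: "regular_sem \<theta>" and \<eta>: "regular_sem \<eta>"
  shows "(\<integral>\<^sup>+X. ennreal (log_ratio \<theta> \<eta> a X) \<partial>sample_law \<theta> a)
    = ennreal (KL (law \<theta> a) (law \<eta> a)) + (\<integral>\<^sup>+X. ennreal (- log_ratio \<theta> \<eta> a X) \<partial>sample_law \<theta> a)"
proof -
  let ?p = "\<integral>\<^sup>+X. ennreal (log_ratio \<theta> \<eta> a X) \<partial>sample_law \<theta> a"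
  let ?n = "\<integral>\<^sup>+X. ennreal (- log_ratio \<theta> \<eta> a X) \<partial>sample_law \<theta> a"
  have int: "integrable (sample_law \<theta> a) (log_ratio \<theta> \<eta> a)" by (rule integrable_log_ratio[OF \<theta> \<eta>])
  then have fin: "?p < \<top>" "?n < \<top>"
    by (simp_all add: real_integrable_def less_top)
  have "KL (law \<theta> a) (law \<eta> a) = enn2real ?p - enn2real ?n"
    unfolding KL_eq_integral[OF \<theta> \<eta>] by (rule real_lebesgue_integral_def[OF int])
  then have "enn2real ?p = KL (law \<theta> a) (law \<eta> a) + enn2real ?n" by simp
  then have "ennreal (enn2real ?p) = ennreal (KL (law \<theta> a) (law \<eta> a)) + ennreal (enn2real ?n)"
    using KL_nonneg[OF \<theta> \<eta>, of a] by simp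
  then show ?thesis using fin by simp
qed

section \<open>Measurability in the action and the one-round kernel\<close>

lemma measurable_fst_action [measurable]: "fst \<in> action_space S \<rightarrow>\<^sub>M count_space UNIV"
  unfolding action_space_def by (intro measurable_restrict_space1) measurable

lemma space_action_space: "space (action_space S) = actions S"
  by (simp add: action_space_def space_restrict_space space_pair_measure)

text \<open>Taking the product over all coordinates, with factor 1 at the target, frees the index
  set from the action.\<close>

lemma measurable_sem_density_pair [measurable]:
  "(\<lambda>(a, X). sem_density \<theta> a X) \<in> borel_measurable (action_space S \<Otimes>\<^sub>M borel)"
proof -
  have "(\<lambda>(a, X). sem_density \<theta> a X) = (\<lambda>(a, X). \<Prod>i\<in>UNIV.
      if fst a = Some i then 1 else normal_density 0 (sqrt (ncov \<theta> $ i $ i)) (resid \<theta> X i))"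
    by (auto simp: sem_density_def active_def fun_eq_iff prod.If_cases Compl_eq)
  also have "\<dots> \<in> borel_measurable (action_space S \<Otimes>\<^sub>M borel)"
    by measurable
  finally show ?thesis .
qed

lemma measurable_log_ratio_pair [measurable]:
  "(\<lambda>(a, X). log_ratio \<theta> \<eta> a X) \<in> borel_measurable (action_space S \<Otimes>\<^sub>M borel)"
proof -
  have [measurable]: "(\<lambda>p. sem_density \<theta> (fst p) (snd p)) \<in> borel_measurable (action_space S \<Otimes>\<^sub>M borel)" for \<theta> :: "'a sem"
    using measurable_sem_density_pair[of \<theta> S] by (simp add: case_prod_beta')
  show ?thesis unfolding log_ratio_def case_prod_beta' by measurable
qed

text \<open>Targets range over a finite type, so it is enough to fix one. The reference measure is
  then fixed too, and the value \<open>u\<close> enters only through the full vector, which leaves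
  an integral depending measurably on a parameter.\<close>

lemma measurable_sample_law:
  fixes \<theta> :: "'p::finite sem"
  assumes \<theta>: "regular_sem \<theta>"
  shows "sample_law \<theta> \<in> action_space S \<rightarrow>\<^sub>M prob_algebra borel"
proof (intro measurable_prob_algebraI measurable_subprob_algebra)
  fix A :: "(real^'p) set" assume "A \<in> sets borel"
  then have A[measurable]: "A \<in> sets borel" .
  interpret L: product_sigma_finite "\<lambda>_::'p. lborel :: real measure" by unfold_locales
  let ?g = "\<lambda>a. \<integral>\<^sup>+x. ennreal (sem_density \<theta> a (full_vec a x)) * indicator A (full_vec a x)
      \<partial>PiM (active a) (\<lambda>_. lborel)"
  have eq: "emeasure (sample_law \<theta> a) A = ?g a" for a
    using nn_integral_sample_law[OF \<theta> borel_measurable_indicator[OF A], of a]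
    by (simp add: sets_sample_law)
  have "?g \<in> borel_measurable (count_space UNIV \<Otimes>\<^sub>M borel)"
  proof (rule measurable_pair_measure_countable1)
    fix o' :: "'p option"
    define R where "R = {i. o' \<noteq> Some i}"
    have R: "active (o', u) = R" for u :: real by (simp add: R_def active_def)
    interpret F: sigma_finite_measure "PiM R (\<lambda>_. lborel :: real measure)"
      by (rule L.sigma_finite) simp
    have [measurable]: "(\<lambda>(u, x). full_vec (o', u) x) \<in> borel \<Otimes>\<^sub>M PiM R (\<lambda>_. lborel) \<rightarrow>\<^sub>M borel"
    proof (rule measurable_vecI)
      fix i
      show "(\<lambda>p. (case p of (u, x) \<Rightarrow> full_vec (o', u) x) $ i) \<in> borel_measurable (borel \<Otimes>\<^sub>M PiM R (\<lambda>_. lborel))"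
      proof (cases "i \<in> R")
        case True
        then have [measurable]: "(\<lambda>x. x i) \<in> borel_measurable (PiM R (\<lambda>_. lborel))"
          using measurable_component_singleton[OF True, of "\<lambda>_. lborel :: real measure"] by simp
        show ?thesis using True by (simp add: full_vec_def R_def case_prod_beta')
      qed (simp add: full_vec_def R_def case_prod_beta')
    qed
    \<comment> \<open>The density depends on the action only through its target, so the value
      \<open>0\<close> is an arbitrary choice.\<close>
    define d where "d = sem_density \<theta> (o', 0)"
    have [measurable]: "d \<in> borel_measurable borel" unfolding d_def by measurable
    have "sem_density \<theta> (o', u) = d" for u
      by (simp add: d_def sem_density_def active_def fun_eq_iff)
    then show "(\<lambda>u. ?g (o', u)) \<in> borel_measurable borel"
      unfolding R by simp
  qed simp
  then show "(\<lambda>a. emeasure (sample_law \<theta> a) A) \<in> borel_measurable (action_space S)"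
    unfolding eq action_space_def by (rule measurable_restrict_space1)
qed (auto simp: sets_sample_law prob_space_sample_law[OF \<theta>] intro: prob_space_imp_subprob_space)

text \<open>The divergence is the integral of a jointly measurable function against a probability
  kernel; \<open>Pair a\<close> carries the action along with the observation.\<close>

lemma measurable_KL_law:
  assumes \<theta>: "regular_sem \<theta>" and \<eta>: "regular_sem \<eta>"
  shows "(\<lambda>a. KL (law \<theta> a) (law \<eta> a)) \<in> borel_measurable (action_space S)"
proof -
  note [measurable] = measurable_sample_law[OF \<theta>]
  have "(\<lambda>a. \<integral>p. (case p of (a, X) \<Rightarrow> log_ratio \<theta> \<eta> a X)
      \<partial>distr (sample_law \<theta> a) (action_space S \<Otimes>\<^sub>M borel) (Pair a)) \<in> borel_measurable (action_space S)"
    by (intro measurable_compose[OF measurable_prob_algebraD integral_measurable_subprob_algebra]) measurable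
  also have "?this \<longleftrightarrow> ?thesis"
  proof (rule measurable_cong)
    fix a assume a: "a \<in> space (action_space S)"
    show "(\<integral>p. (case p of (a, X) \<Rightarrow> log_ratio \<theta> \<eta> a X)
      \<partial>distr (sample_law \<theta> a) (action_space S \<Otimes>\<^sub>M borel) (Pair a)) = KL (law \<theta> a) (law \<eta> a)"
      unfolding KL_eq_integral[OF \<theta> \<eta>] by (subst integral_distr) (use a in auto)
  qed
  finally show ?thesis .
qed

lemma measurable_round_kernel_step:
  assumes \<theta>: "regular_sem \<theta>"
  shows "(\<lambda>a. distr (sample_law \<theta> a) (round_space S) (Pair a)) \<in> action_space S \<rightarrow>\<^sub>M prob_algebra (round_space S)"
proof -
  note [measurable] = measurable_sample_law[OF \<theta>]
  show ?thesis unfolding round_space_def by measurable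
qed

lemma measurable_policy:
  assumes "is_algorithm S \<A>"
  shows "policy \<A> i \<in> PiM {0..<i} (\<lambda>_. round_space S) \<rightarrow>\<^sub>M prob_algebra (action_space S)"
  using assms by (simp add: is_algorithm_def)

lemma measurable_round_kernel:
  assumes \<theta>: "regular_sem \<theta>" and \<A>: "is_algorithm S \<A>"
  shows "round_kernel S \<A> \<theta> i \<in> PiM {0..<i} (\<lambda>_. round_space S) \<rightarrow>\<^sub>M prob_algebra (round_space S)"
  unfolding round_kernel_def
  by (rule measurable_bind_prob_space[OF measurable_policy[OF \<A>] measurable_round_kernel_step[OF \<theta>]])

lemma nn_integral_round_kernel:
  assumes \<theta>: "regular_sem \<theta>" and \<A>: "is_algorithm S \<A>"
    and h: "h \<in> space (PiM {0..<i} (\<lambda>_. round_space S))"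
    and f[measurable]: "f \<in> borel_measurable (round_space S)"
  shows "(\<integral>\<^sup>+y. f y \<partial>round_kernel S \<A> \<theta> i h)
    = (\<integral>\<^sup>+a. \<integral>\<^sup>+X. f (a, X) \<partial>sample_law \<theta> a \<partial>policy \<A> i h)"
proof -
  have "policy \<A> i h \<in> space (prob_algebra (action_space S))"
    using measurable_space[OF measurable_policy[OF \<A>] h] .
  then have sets: "sets (policy \<A> i h) = sets (action_space S)"
    by (simp add: space_prob_algebra)
  note [measurable_cong] = sets
  have "(\<integral>\<^sup>+y. f y \<partial>round_kernel S \<A> \<theta> i h)
    = (\<integral>\<^sup>+a. (\<integral>\<^sup>+y. f y \<partial>distr (sample_law \<theta> a) (round_space S) (Pair a)) \<partial>policy \<A> i h)"
    unfolding round_kernel_def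
    by (rule nn_integral_bind[OF f])
      (simp add: measurable_cong_sets[OF sets refl] measurable_prob_algebraD[OF measurable_round_kernel_step[OF \<theta>]])
  also have "\<dots> = (\<integral>\<^sup>+a. \<integral>\<^sup>+X. f (a, X) \<partial>sample_law \<theta> a \<partial>policy \<A> i h)"
  proof (intro nn_integral_cong)
    fix a assume "a \<in> space (policy \<A> i h)"
    then have a: "a \<in> space (action_space S)" using sets_eq_imp_space_eq[OF sets] by simp
    then have [measurable]: "Pair a \<in> sample_law \<theta> a \<rightarrow>\<^sub>M round_space S"
      unfolding round_space_def by simp
    show "(\<integral>\<^sup>+y. f y \<partial>distr (sample_law \<theta> a) (round_space S) (Pair a)) = (\<integral>\<^sup>+X. f (a, X) \<partial>sample_law \<theta> a)"
      by (rule nn_integral_distr) measurable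
  qed
  finally show ?thesis .
qed

text \<open>The policy does not know the parameter, so both kernels draw the action in the same way
  and differ only in the law of the observation.\<close>

lemma nn_integral_round_kernel_change:
  assumes \<theta>: "regular_sem \<theta>" and \<eta>: "regular_sem \<eta>" and \<A>: "is_algorithm S \<A>"
    and h: "h \<in> space (PiM {0..<i} (\<lambda>_. round_space S))"
    and f[measurable]: "f \<in> borel_measurable (round_space S)"
  shows "(\<integral>\<^sup>+y. f y \<partial>round_kernel S \<A> \<eta> i h)
    = (\<integral>\<^sup>+y. ennreal (exp (- log_ratio \<theta> \<eta> (fst y) (snd y))) * f y \<partial>round_kernel S \<A> \<theta> i h)"
proof -
  have [measurable]: "(\<lambda>y. log_ratio \<theta> \<eta> (fst y) (snd y)) \<in> borel_measurable (round_space S)"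
    using measurable_log_ratio_pair[of \<theta> \<eta> S] by (simp add: case_prod_beta' round_space_def)
  have sp: "space (policy \<A> i h) = space (action_space S)"
    using measurable_space[OF measurable_policy[OF \<A>] h] by (auto simp: space_prob_algebra dest: sets_eq_imp_space_eq)
  have "(\<integral>\<^sup>+X. f (a, X) \<partial>sample_law \<eta> a)
      = (\<integral>\<^sup>+X. ennreal (exp (- log_ratio \<theta> \<eta> a X)) * f (a, X) \<partial>sample_law \<theta> a)"
    if "a \<in> space (action_space S)" for a
  proof -
    have [measurable]: "(\<lambda>X. f (a, X)) \<in> borel_measurable borel"
      using measurable_compose[OF measurable_Pair1'[OF that, of borel] f[unfolded round_space_def]] .
    show ?thesis
      unfolding sample_law_density[OF \<theta> \<eta>] by (rule nn_integral_density) auto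
  qed
  then show ?thesis
    by (simp add: nn_integral_round_kernel[OF _ \<A> h] \<theta> \<eta> sp cong: nn_integral_cong_simp)
qed

section \<open>Change of measure along trajectories\<close>

context Ionescu_Tulcea
begin

text \<open>\<open>C 0 n\<close>, started at the only history of length zero, is the law of the
  first \<open>n\<close> rounds; the next round is bound to it by \<open>eP n\<close>, which appends
  coordinate \<open>n\<close>.\<close>

lemma nn_integral_C_Suc:
  assumes f[measurable]: "f \<in> borel_measurable (PiM {0..<Suc n} M)"
  shows "(\<integral>\<^sup>+h. f h \<partial>C 0 (Suc n) (\<lambda>_. undefined))
    = (\<integral>\<^sup>+h. (\<integral>\<^sup>+y. f (h(n := y)) \<partial>P n h) \<partial>C 0 n (\<lambda>_. undefined))"
proof -
  let ?u = "\<lambda>_. undefined"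
  have u: "?u \<in> space (PiM {0..<0} M)" by simp
  have "(\<integral>\<^sup>+h. f h \<partial>C 0 (Suc n) ?u) = (\<integral>\<^sup>+h. (\<integral>\<^sup>+h'. f h' \<partial>eP n h) \<partial>C 0 n ?u)"
    using measurable_eP[of n]
    by (simp, subst nn_integral_bind[OF f]) (auto simp: measurable_cong_sets[OF sets_C[OF u, of n] refl])
  also have "\<dots> = (\<integral>\<^sup>+h. (\<integral>\<^sup>+y. f (h(n := y)) \<partial>P n h) \<partial>C 0 n ?u)"
    by (intro nn_integral_cong nn_integral_eP f) (simp add: space_C[OF u])
  finally show ?thesis .
qed

lemma nn_integral_lim_restrict:
  assumes f[measurable]: "f \<in> borel_measurable (PiM {0..<n} M)"
  shows "(\<integral>\<^sup>+\<omega>. f (restrict \<omega> {0..<n}) \<partial>PF.lim) = (\<integral>\<^sup>+h. f h \<partial>C 0 n (\<lambda>_. undefined))"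
proof -
  have u: "(\<lambda>_. undefined) \<in> space (PiM {0..<0} M)" by simp
  have r: "(\<lambda>\<omega>. restrict \<omega> {0..<n}) \<in> PF.lim \<rightarrow>\<^sub>M PiM {0..<n} M"
    by (simp add: measurable_cong_sets[OF PF.sets_lim refl] measurable_restrict_subset)
  have r': "(\<lambda>\<omega>. restrict \<omega> {0..<n}) \<in> C 0 n (\<lambda>_. undefined) \<rightarrow>\<^sub>M PiM {0..<n} M"
    using measurable_restrict_subset[of "{0..<n}" "{0..<n}" M]
    by (simp add: measurable_cong_sets[OF sets_C[OF u, of n] refl])
  \<comment> \<open>\<open>CI\<close> of an index set is built from the law up to the least horizon
    that covers the set.\<close>
  have n: "up_to {0..<n} = n"
  proof (rule antisym)
    show "up_to {0..<n} \<le> n" by (simp add: up_to_iff)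
    show "n \<le> up_to {0..<n}" using up_to[of "{0..<n}"] by (cases "n = 0") auto
  qed
  have "(\<integral>\<^sup>+\<omega>. f (restrict \<omega> {0..<n}) \<partial>PF.lim) = (\<integral>\<^sup>+h. f h \<partial>distr PF.lim (PiM {0..<n} M) (\<lambda>\<omega>. restrict \<omega> {0..<n}))"
    using nn_integral_distr[OF r, of f] f by simp
  also have "\<dots> = (\<integral>\<^sup>+h. f h \<partial>distr (C 0 n (\<lambda>_. undefined)) (PiM {0..<n} M) (\<lambda>\<omega>. restrict \<omega> {0..<n}))"
    by (simp add: distr_lim CI_def n)
  also have "\<dots> = (\<integral>\<^sup>+h. f (restrict h {0..<n}) \<partial>C 0 n (\<lambda>_. undefined))"
    using nn_integral_distr[OF r', of f] f by simp
  also have "\<dots> = (\<integral>\<^sup>+h. f h \<partial>C 0 n (\<lambda>_. undefined))"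
    using space_C[OF u, of n]
    by (intro nn_integral_cong arg_cong[where f=f]) (auto simp: space_PiM extensional_restrict PiE_def)
  finally show ?thesis .
qed

text \<open>This expresses that \<open>P n h\<close> is the conditional law of coordinate
  \<open>n\<close> given the past \<open>h\<close>, tested on products of a function of the past and
  a function of that coordinate.\<close>

lemma nn_integral_lim_step:
  assumes g[measurable]: "g \<in> borel_measurable (PiM {0..<n} M)" and f[measurable]: "f \<in> borel_measurable (M n)"
  shows "(\<integral>\<^sup>+\<omega>. g (restrict \<omega> {0..<n}) * f (\<omega> n) \<partial>PF.lim)
    = (\<integral>\<^sup>+h. g h * (\<integral>\<^sup>+y. f y \<partial>P n h) \<partial>C 0 n (\<lambda>_. undefined))"
proof -
  have u: "(\<lambda>_. undefined) \<in> space (PiM {0..<0} M)" by simp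
  have [measurable]: "(\<lambda>h. restrict h {0..<n}) \<in> PiM {0..<Suc n} M \<rightarrow>\<^sub>M PiM {0..<n} M"
    by (rule measurable_restrict_subset) auto
  have [measurable]: "(\<lambda>h. h n) \<in> PiM {0..<Suc n} M \<rightarrow>\<^sub>M M n" by simp
  let ?f = "\<lambda>h. g (restrict h {0..<n}) * f (h n)"
  have f': "?f \<in> borel_measurable (PiM {0..<Suc n} M)" by measurable
  have "(\<integral>\<^sup>+\<omega>. g (restrict \<omega> {0..<n}) * f (\<omega> n) \<partial>PF.lim) = (\<integral>\<^sup>+\<omega>. ?f (restrict \<omega> {0..<Suc n}) \<partial>PF.lim)"
    by (intro nn_integral_cong) (auto simp: restrict_restrict Int_absorb1)
  also have "\<dots> = (\<integral>\<^sup>+h. (\<integral>\<^sup>+y. ?f (h(n := y)) \<partial>P n h) \<partial>C 0 n (\<lambda>_. undefined))"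
    by (simp only: nn_integral_lim_restrict[OF f'] nn_integral_C_Suc[OF f'])
  also have "\<dots> = (\<integral>\<^sup>+h. g h * (\<integral>\<^sup>+y. f y \<partial>P n h) \<partial>C 0 n (\<lambda>_. undefined))"
  proof (intro nn_integral_cong)
    fix h assume "h \<in> space (C 0 n (\<lambda>_. undefined))"
    then have h: "h \<in> space (PiM {0..<n} M)" using space_C[OF u, of n] by simp
    then have "restrict (h(n := y)) {0..<n} = h" for y
      by (auto simp: space_PiM PiE_def extensional_def restrict_def fun_eq_iff)
    moreover have "f \<in> borel_measurable (P n h)"
      by (simp add: measurable_cong_sets[OF sets_P[OF h] refl])
    ultimately show "(\<integral>\<^sup>+y. ?f (h(n := y)) \<partial>P n h) = g h * (\<integral>\<^sup>+y. f y \<partial>P n h)"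
      by (simp add: nn_integral_cmult)
  qed
  finally show ?thesis .
qed

end

text \<open>Induction on the horizon, for all \<open>f\<close> at once: integrating out the last
  round under \<open>Q\<close> leaves a function of the shorter history, to which the induction
  hypothesis applies; then the last kernel is exchanged at the cost of the factor
  \<open>r n\<close>.\<close>

lemma Ionescu_Tulcea_change_of_measure:
  fixes M :: "nat \<Rightarrow> 'a measure"
  assumes "Ionescu_Tulcea P M" and "Ionescu_Tulcea Q M"
    and r[measurable]: "\<And>i. r i \<in> borel_measurable (M i)"
    and change: "\<And>i h f. h \<in> space (PiM {0..<i} M) \<Longrightarrow> f \<in> borel_measurable (M i) \<Longrightarrow>
      (\<integral>\<^sup>+y. f y \<partial>Q i h) = (\<integral>\<^sup>+y. r i y * f y \<partial>P i h)"
    and f: "f \<in> borel_measurable (PiM {0..<n} M)"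
  shows "(\<integral>\<^sup>+h. f h \<partial>Ionescu_Tulcea.C Q M 0 n (\<lambda>_. undefined))
    = (\<integral>\<^sup>+h. (\<Prod>i<n. r i (h i)) * f h \<partial>Ionescu_Tulcea.C P M 0 n (\<lambda>_. undefined))"
proof -
  interpret P: Ionescu_Tulcea P M by fact
  interpret Q: Ionescu_Tulcea Q M by fact
  have u: "(\<lambda>_. undefined) \<in> space (PiM {0..<0} M)" by simp
  show ?thesis
    using f
  proof (induction n arbitrary: f)
    case 0
    then show ?case by simp
  next
    case (Suc n)
    note [measurable] = Suc.prems
    have [measurable]: "(\<lambda>h. h i) \<in> PiM {0..<m} M \<rightarrow>\<^sub>M M i" if "i < m" for i m
      by (rule measurable_component_singleton) (use that in simp)
    have upd: "(\<lambda>(h, y). h(n := y)) \<in> PiM {0..<n} M \<Otimes>\<^sub>M M n \<rightarrow>\<^sub>M PiM {0..<Suc n} M"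
      unfolding case_prod_beta' by (rule measurable_fun_upd[where J="{0..<n}"]) auto
    then have fm: "(\<lambda>(h, y). f (h(n := y))) \<in> borel_measurable (PiM {0..<n} M \<Otimes>\<^sub>M M n)"
      using measurable_compose[OF upd Suc.prems] by (simp add: case_prod_beta')
    have meas: "(\<lambda>h. \<integral>\<^sup>+y. f (h(n := y)) \<partial>Q n h) \<in> borel_measurable (PiM {0..<n} M)"
      by (rule nn_integral_measurable_subprob_algebra2[OF fm Q.P])
    have meas': "(\<lambda>h. (\<Prod>i<Suc n. r i (h i)) * f h) \<in> borel_measurable (PiM {0..<Suc n} M)"
      by measurable
    have "(\<integral>\<^sup>+h. f h \<partial>Q.C 0 (Suc n) (\<lambda>_. undefined))
        = (\<integral>\<^sup>+h. (\<Prod>i<n. r i (h i)) * (\<integral>\<^sup>+y. f (h(n := y)) \<partial>Q n h) \<partial>P.C 0 n (\<lambda>_. undefined))"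
      unfolding Q.nn_integral_C_Suc[OF Suc.prems] by (rule Suc.IH[OF meas])
    also have "\<dots> = (\<integral>\<^sup>+h. (\<integral>\<^sup>+y. (\<Prod>i<Suc n. r i ((h(n := y)) i)) * f (h(n := y)) \<partial>P n h) \<partial>P.C 0 n (\<lambda>_. undefined))"
    proof (intro nn_integral_cong)
      fix h assume "h \<in> space (P.C 0 n (\<lambda>_. undefined))"
      then have h: "h \<in> space (PiM {0..<n} M)" using P.space_C[OF u, of n] by simp
      have fh: "(\<lambda>y. f (h(n := y))) \<in> borel_measurable (M n)"
        using measurable_compose[OF measurable_Pair1'[OF h] fm] by simp
      have "(\<Prod>i<n. r i (h i)) * (\<integral>\<^sup>+y. f (h(n := y)) \<partial>Q n h)
          = (\<Prod>i<n. r i (h i)) * (\<integral>\<^sup>+y. r n y * f (h(n := y)) \<partial>P n h)"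
        by (simp only: change[OF h fh])
      also have "\<dots> = (\<integral>\<^sup>+y. (\<Prod>i<n. r i (h i)) * (r n y * f (h(n := y))) \<partial>P n h)"
        using fh by (intro nn_integral_cmult[symmetric]) (simp add: measurable_cong_sets[OF P.sets_P[OF h] refl])
      also have "\<dots> = (\<integral>\<^sup>+y. (\<Prod>i<Suc n. r i ((h(n := y)) i)) * f (h(n := y)) \<partial>P n h)"
        by (simp add: mult.assoc)
      finally show "(\<Prod>i<n. r i (h i)) * (\<integral>\<^sup>+y. f (h(n := y)) \<partial>Q n h)
          = (\<integral>\<^sup>+y. (\<Prod>i<Suc n. r i ((h(n := y)) i)) * f (h(n := y)) \<partial>P n h)" .
    qed
    also have "\<dots> = (\<integral>\<^sup>+h. (\<Prod>i<Suc n. r i (h i)) * f h \<partial>P.C 0 (Suc n) (\<lambda>_. undefined))"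
      by (rule P.nn_integral_C_Suc[OF meas', symmetric])
    finally show ?case .
  qed
qed

section \<open>Trajectory laws and the filtration of histories\<close>

abbreviation traj_space :: "'p::finite setting \<Rightarrow> 'p trajectory measure" where
  "traj_space S \<equiv> PiM UNIV (\<lambda>_. round_space S)"

lemma Ionescu_Tulcea_round_kernel:
  assumes \<theta>: "regular_sem \<theta>" and \<A>: "is_algorithm S \<A>"
  shows "Ionescu_Tulcea (round_kernel S \<A> \<theta>) (\<lambda>_. round_space S)"
proof (rule Ionescu_Tulcea.intro)
  note K = measurable_round_kernel[OF \<theta> \<A>]
  show "round_kernel S \<A> \<theta> i \<in> PiM {0..<i} (\<lambda>_. round_space S) \<rightarrow>\<^sub>M subprob_algebra (round_space S)" for i
    by (rule measurable_prob_algebraD[OF K])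
  show "prob_space (round_kernel S \<A> \<theta> i h)" if "h \<in> space (PiM {0..<i} (\<lambda>_. round_space S))" for i h
    using measurable_space[OF K that] by (simp add: space_prob_algebra)
qed

lemma
  assumes \<theta>: "regular_sem \<theta>" and \<A>: "is_algorithm S \<A>"
  shows sets_traj_law: "sets (traj_law S \<A> \<theta>) = sets (traj_space S)"
    and space_traj_law: "space (traj_law S \<A> \<theta>) = space (traj_space S)"
    and prob_space_traj_law: "prob_space (traj_law S \<A> \<theta>)"
proof -
  interpret P: Ionescu_Tulcea "round_kernel S \<A> \<theta>" "\<lambda>_. round_space S"
    by (rule Ionescu_Tulcea_round_kernel[OF assms])
  show "sets (traj_law S \<A> \<theta>) = sets (traj_space S)" "space (traj_law S \<A> \<theta>) = space (traj_space S)"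
    unfolding traj_law_def by (rule P.PF.sets_lim P.PF.space_lim)+
  show "prob_space (traj_law S \<A> \<theta>)"
    using P.nn_integral_lim_restrict[of "\<lambda>_. 1" 0]
    unfolding traj_law_def by (intro prob_spaceI) simp
qed

lemma restrict_traj_measurable [measurable]:
  "(\<lambda>\<omega>. restrict \<omega> {0..<n}) \<in> traj_space S \<rightarrow>\<^sub>M PiM {0..<n} (\<lambda>_. round_space S)"
  by (rule measurable_restrict_subset) simp

lemma space_history: "space (history S t) = space (traj_space S)"
  by (simp add: history_def)

lemma sets_history:
  "sets (history S (enat n)) = {(\<lambda>\<omega>. restrict \<omega> {0..<n}) -` B \<inter> space (traj_space S) | B.
     B \<in> sets (PiM {0..<n} (\<lambda>_. round_space S))}"
proof -
  have "{i. enat i < enat n} = {0..<n}" by auto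
  then show ?thesis
    unfolding history_def
    using sets_vimage_algebra2[OF measurable_space[OF restrict_traj_measurable[of n S], THEN Pi_I]]
    by simp
qed

lemma history_subset_traj: "A \<in> sets (history S (enat n)) \<Longrightarrow> A \<in> sets (traj_space S)"
  unfolding sets_history by (auto intro: measurable_sets[OF restrict_traj_measurable])

lemma history_mono:
  assumes "m \<le> n" "A \<in> sets (history S (enat m))"
  shows "A \<in> sets (history S (enat n))"
proof -
  from assms(2) obtain B where B[measurable]: "B \<in> sets (PiM {0..<m} (\<lambda>_. round_space S))"
    and A: "A = (\<lambda>\<omega>. restrict \<omega> {0..<m}) -` B \<inter> space (traj_space S)"
    unfolding sets_history by auto
  have r: "(\<lambda>h. restrict h {0..<m}) \<in> PiM {0..<n} (\<lambda>_. round_space S) \<rightarrow>\<^sub>M PiM {0..<m} (\<lambda>_. round_space S)"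
    by (rule measurable_restrict_subset) (use assms(1) in auto)
  have "(\<lambda>h. restrict h {0..<m}) -` B \<inter> space (PiM {0..<n} (\<lambda>_. round_space S)) \<in> sets (PiM {0..<n} (\<lambda>_. round_space S))"
    (is "?B \<in> _")
    by (rule measurable_sets[OF r B])
  moreover have "A = (\<lambda>\<omega>. restrict \<omega> {0..<n}) -` ?B \<inter> space (traj_space S)"
    unfolding A using assms(1) measurable_space[OF restrict_traj_measurable[of n S]]
    by (auto simp: restrict_restrict Int_absorb1 min_absorb2)
  ultimately show ?thesis unfolding sets_history by blast
qed

lemma measurable_traj_component [measurable]: "(\<lambda>\<omega>. \<omega> i) \<in> traj_space S \<rightarrow>\<^sub>M round_space S"
  by (rule measurable_component_singleton) simp

text \<open>An event of the first \<open>n\<close> rounds is a cylinder, so its probability is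
  computed at horizon \<open>n\<close>, where the density is a product of one-round ratios.\<close>

lemma emeasure_traj_law_change:
  assumes \<theta>: "regular_sem \<theta>" and \<eta>: "regular_sem \<eta>" and \<A>: "is_algorithm S \<A>"
    and A: "A \<in> sets (history S (enat n))"
  shows "emeasure (traj_law S \<A> \<eta>) A
    = (\<integral>\<^sup>+\<omega>. (\<Prod>i<n. ennreal (exp (- log_ratio \<theta> \<eta> (fst (\<omega> i)) (snd (\<omega> i))))) * indicator A \<omega>
        \<partial>traj_law S \<A> \<theta>)"
proof -
  interpret P: Ionescu_Tulcea "round_kernel S \<A> \<theta>" "\<lambda>_. round_space S"
    by (rule Ionescu_Tulcea_round_kernel[OF \<theta> \<A>])
  interpret Q: Ionescu_Tulcea "round_kernel S \<A> \<eta>" "\<lambda>_. round_space S"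
    by (rule Ionescu_Tulcea_round_kernel[OF \<eta> \<A>])
  let ?r = "\<lambda>y. ennreal (exp (- log_ratio \<theta> \<eta> (fst y) (snd y)))"
  have r[measurable]: "?r \<in> borel_measurable (round_space S)"
    using measurable_log_ratio_pair[of \<theta> \<eta> S] by (simp add: case_prod_beta' round_space_def)
  from A obtain B where B[measurable]: "B \<in> sets (PiM {0..<n} (\<lambda>_. round_space S))"
    and AB: "A = (\<lambda>\<omega>. restrict \<omega> {0..<n}) -` B \<inter> space (traj_space S)"
    unfolding sets_history by auto
  have [measurable]: "(\<lambda>h. h i) \<in> PiM {0..<n} (\<lambda>_. round_space S) \<rightarrow>\<^sub>M round_space S" if "i < n" for i
    by (rule measurable_component_singleton) (use that in simp)
  have ind: "indicator A \<omega> = (indicator B (restrict \<omega> {0..<n}) :: ennreal)" if "\<omega> \<in> space (traj_space S)" for \<omega>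
    using that by (auto simp: AB indicator_def)
  have "emeasure (traj_law S \<A> \<eta>) A = (\<integral>\<^sup>+\<omega>. indicator A \<omega> \<partial>traj_law S \<A> \<eta>)"
    using history_subset_traj[OF A] by (simp add: sets_traj_law[OF \<eta> \<A>])
  also have "\<dots> = (\<integral>\<^sup>+\<omega>. indicator B (restrict \<omega> {0..<n}) \<partial>Q.PF.lim)"
    unfolding traj_law_def by (intro nn_integral_cong ind) simp
  also have "\<dots> = (\<integral>\<^sup>+h. indicator B h \<partial>Q.C 0 n (\<lambda>_. undefined))"
    by (rule Q.nn_integral_lim_restrict) measurable
  also have "\<dots> = (\<integral>\<^sup>+h. (\<Prod>i<n. ?r (h i)) * indicator B h \<partial>P.C 0 n (\<lambda>_. undefined))"
    by (rule Ionescu_Tulcea_change_of_measure[where r="\<lambda>_. ?r",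
          OF P.Ionescu_Tulcea_axioms Q.Ionescu_Tulcea_axioms r
            nn_integral_round_kernel_change[OF \<theta> \<eta> \<A>] borel_measurable_indicator[OF B]])
  also have "\<dots> = (\<integral>\<^sup>+\<omega>. (\<Prod>i<n. ?r (restrict \<omega> {0..<n} i)) * indicator B (restrict \<omega> {0..<n}) \<partial>P.PF.lim)"
    by (rule P.nn_integral_lim_restrict[symmetric]) measurable
  also have "\<dots> = (\<integral>\<^sup>+\<omega>. (\<Prod>i<n. ?r (\<omega> i)) * indicator A \<omega> \<partial>traj_law S \<A> \<theta>)"
    unfolding traj_law_def
    by (intro nn_integral_cong arg_cong2[where f="(*)"] prod.cong ind[symmetric]) simp_all
  finally show ?thesis .
qed

text \<open>Conditioning on the history and on the next action: the event is decided by the first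
  \<open>n\<close> rounds, while coordinate \<open>n\<close> belongs to round \<open>n + 1\<close>.
  Functions of that round with equal means given each action are therefore interchangeable on the
  event.\<close>

lemma nn_integral_traj_law_round:
  assumes \<theta>: "regular_sem \<theta>" and \<A>: "is_algorithm S \<A>"
    and A: "A \<in> sets (history S (enat n))"
    and f: "f \<in> borel_measurable (round_space S)" and g: "g \<in> borel_measurable (round_space S)"
    and fg: "\<And>a. a \<in> space (action_space S) \<Longrightarrow>
      (\<integral>\<^sup>+X. f (a, X) \<partial>sample_law \<theta> a) = (\<integral>\<^sup>+X. g (a, X) \<partial>sample_law \<theta> a)"
  shows "(\<integral>\<^sup>+\<omega>. indicator A \<omega> * f (\<omega> n) \<partial>traj_law S \<A> \<theta>)
    = (\<integral>\<^sup>+\<omega>. indicator A \<omega> * g (\<omega> n) \<partial>traj_law S \<A> \<theta>)"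
proof -
  interpret P: Ionescu_Tulcea "round_kernel S \<A> \<theta>" "\<lambda>_. round_space S"
    by (rule Ionescu_Tulcea_round_kernel[OF \<theta> \<A>])
  from A obtain B where B[measurable]: "B \<in> sets (PiM {0..<n} (\<lambda>_. round_space S))"
    and AB: "A = (\<lambda>\<omega>. restrict \<omega> {0..<n}) -` B \<inter> space (traj_space S)"
    unfolding sets_history by auto
  have ind: "indicator A \<omega> = (indicator B (restrict \<omega> {0..<n}) :: ennreal)" if "\<omega> \<in> space (traj_space S)" for \<omega>
    using that by (auto simp: AB indicator_def)
  have eq: "(\<integral>\<^sup>+\<omega>. indicator A \<omega> * f (\<omega> n) \<partial>traj_law S \<A> \<theta>)
      = (\<integral>\<^sup>+h. indicator B h * (\<integral>\<^sup>+y. f y \<partial>round_kernel S \<A> \<theta> n h) \<partial>P.C 0 n (\<lambda>_. undefined))"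
    if f: "f \<in> borel_measurable (round_space S)" for f
  proof -
    have "(\<integral>\<^sup>+\<omega>. indicator A \<omega> * f (\<omega> n) \<partial>traj_law S \<A> \<theta>)
        = (\<integral>\<^sup>+\<omega>. indicator B (restrict \<omega> {0..<n}) * f (\<omega> n) \<partial>P.PF.lim)"
      unfolding traj_law_def by (intro nn_integral_cong arg_cong2[where f="(*)"] ind) simp_all
    then show ?thesis using P.nn_integral_lim_step[OF borel_measurable_indicator[OF B] f] by simp
  qed
  have u: "(\<lambda>_. undefined) \<in> space (PiM {0..<0::nat} (\<lambda>_. round_space S))" by simp
  show ?thesis
    unfolding eq[OF f] eq[OF g]
  proof (rule nn_integral_cong)
    fix h assume "h \<in> space (P.C 0 n (\<lambda>_. undefined))"
    then have h: "h \<in> space (PiM {0..<n} (\<lambda>_. round_space S))" using P.space_C[OF u, of n] by simp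
    then have "space (policy \<A> n h) = space (action_space S)"
      using measurable_space[OF measurable_policy[OF \<A>] h] by (auto simp: space_prob_algebra dest: sets_eq_imp_space_eq)
    then have "(\<integral>\<^sup>+y. f y \<partial>round_kernel S \<A> \<theta> n h) = (\<integral>\<^sup>+y. g y \<partial>round_kernel S \<A> \<theta> n h)"
      unfolding nn_integral_round_kernel[OF \<theta> \<A> h f] nn_integral_round_kernel[OF \<theta> \<A> h g]
      by (intro nn_integral_cong fg) simp
    then show "indicator B h * (\<integral>\<^sup>+y. f y \<partial>round_kernel S \<A> \<theta> n h)
        = indicator B h * (\<integral>\<^sup>+y. g y \<partial>round_kernel S \<A> \<theta> n h)" by simp
  qed
qed

section \<open>The stopped log-likelihood ratio\<close>

text \<open>In this form the divergence is the value at \<open>x = 1 - \<delta>\<close> of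
  \<open>(2 * x - 1) * ln ((1 - \<delta>) / \<delta>)\<close>, the expression produced by the
  tangent argument.\<close>

lemma kl_complement:
  assumes "0 < \<delta>" "\<delta> < 1"
  shows "kl (1 - \<delta>) \<delta> = (1 - 2 * \<delta>) * ln ((1 - \<delta>) / \<delta>)"
proof -
  have "ln (\<delta> / (1 - \<delta>)) = - ln ((1 - \<delta>) / \<delta>)"
    using assms by (simp add: ln_div)
  then show ?thesis by (simp add: kl_def algebra_simps)
qed

locale two_models =
  fixes S :: "'p::finite setting" and \<A> :: "'p algorithm" and \<theta> \<eta> :: "'p sem"
  assumes \<theta>: "regular_sem \<theta>" and \<eta>: "regular_sem \<eta>" and \<A>: "is_algorithm S \<A>"
begin

abbreviation "P \<equiv> traj_law S \<A> \<theta>"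
abbreviation "Q \<equiv> traj_law S \<A> \<eta>"
abbreviation "\<Omega> \<equiv> space (traj_space S)"

sublocale P: prob_space P by (rule prob_space_traj_law[OF \<theta> \<A>])
sublocale Q: prob_space Q by (rule prob_space_traj_law[OF \<eta> \<A>])

declare sets_traj_law[OF \<theta> \<A>, measurable_cong] and sets_traj_law[OF \<eta> \<A>, measurable_cong]

lemma space_P [simp]: "space P = \<Omega>" and space_Q [simp]: "space Q = \<Omega>"
  by (rule space_traj_law[OF \<theta> \<A>] space_traj_law[OF \<eta> \<A>])+

definition z :: "nat \<Rightarrow> 'p trajectory \<Rightarrow> real" where
  "z i \<omega> = log_ratio \<theta> \<eta> (fst (\<omega> i)) (snd (\<omega> i))"

definition info :: "nat \<Rightarrow> 'p trajectory \<Rightarrow> ennreal" where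
  "info i \<omega> = ennreal (KL (law \<theta> (fst (\<omega> i))) (law \<eta> (fst (\<omega> i))))"

lemma measurable_log_ratio_round [measurable]:
  "(\<lambda>y. log_ratio \<theta> \<eta> (fst y) (snd y)) \<in> borel_measurable (round_space S)"
  using measurable_log_ratio_pair[of \<theta> \<eta> S] by (simp add: case_prod_beta' round_space_def)

lemma measurable_KL_round [measurable]:
  "(\<lambda>y. KL (law \<theta> (fst y)) (law \<eta> (fst y))) \<in> borel_measurable (round_space S)"
  unfolding round_space_def using measurable_compose[OF measurable_fst measurable_KL_law[OF \<theta> \<eta>]] .

lemma measurable_z [measurable]: "z i \<in> borel_measurable (traj_space S)"
  unfolding z_def using measurable_compose[OF measurable_traj_component measurable_log_ratio_round] .

lemma measurable_info [measurable]: "info i \<in> borel_measurable (traj_space S)"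
  unfolding info_def using measurable_compose[OF measurable_traj_component measurable_KL_round] by simp

section \<open>Truncated stopping times and the stopped likelihood ratio\<close>

lemma stop_le_history: "{\<omega> \<in> \<Omega>. stop \<A> \<omega> \<le> enat n} \<in> sets (history S (enat n))"
proof -
  have "stopping_time (history S) (stop \<A>)" using \<A> by (simp add: is_algorithm_def)
  from stopping_timeD[OF this, of "enat n"] show ?thesis
    by (simp add: pred_def space_history)
qed

text \<open>On this event coordinate \<open>n\<close> is still played; whether it is played is
  settled by the first \<open>n\<close> rounds, as its complement is the event of having stopped by
  time \<open>n\<close>.\<close>

lemma alive_history: "{\<omega> \<in> \<Omega>. enat n < stop \<A> \<omega>} \<in> sets (history S (enat n))"
proof -
  have "{\<omega> \<in> \<Omega>. enat n < stop \<A> \<omega>} = space (history S (enat n)) - {\<omega> \<in> \<Omega>. stop \<A> \<omega> \<le> enat n}"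
    by (auto simp: space_history)
  then show ?thesis using stop_le_history[of n] by simp
qed

lemma alive_measurable [measurable]: "Measurable.pred (traj_space S) (\<lambda>\<omega>. enat n < stop \<A> \<omega>)"
  using history_subset_traj[OF alive_history] by (simp add: pred_def)

text \<open>The minimum with \<open>enat n\<close> is finite, so \<open>the_enat\<close> never meets
  the infinite value.\<close>

definition stopped :: "nat \<Rightarrow> 'p trajectory \<Rightarrow> nat" where
  "stopped n \<omega> = the_enat (min (stop \<A> \<omega>) (enat n))"

lemma less_stopped_iff: "i < stopped n \<omega> \<longleftrightarrow> i < n \<and> enat i < stop \<A> \<omega>"
  unfolding stopped_def by (cases "stop \<A> \<omega>") (auto simp: min_def)

lemma stopped_le: "stopped n \<omega> \<le> n"
  unfolding stopped_def by (cases "stop \<A> \<omega>") (auto simp: min_def)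

lemma stopped_eq: "stop \<A> \<omega> \<le> enat n \<Longrightarrow> stopped n \<omega> = the_enat (stop \<A> \<omega>)"
  unfolding stopped_def by (simp add: min_absorb1)

text \<open>The value \<open>t\<close> is taken when round \<open>t\<close> is played and round
  \<open>t + 1\<close> is not; at \<open>t = n\<close> the truncation removes the second condition.
  Both are decided by the first \<open>t\<close> rounds.\<close>

lemma stopped_history:
  assumes "t \<le> n"
  shows "{\<omega> \<in> \<Omega>. stopped n \<omega> = t} \<in> sets (history S (enat t))"
proof -
  have ge: "{\<omega> \<in> \<Omega>. t \<le> stopped n \<omega>} \<in> sets (history S (enat t))"
  proof (cases t)
    case 0
    then show ?thesis using sets.top[of "history S (enat t)"] by (simp add: space_history)
  next
    case (Suc m)
    then have "{\<omega> \<in> \<Omega>. t \<le> stopped n \<omega>} = {\<omega> \<in> \<Omega>. enat m < stop \<A> \<omega>}"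
      using assms by (auto simp: Suc_le_eq less_stopped_iff)
    then show ?thesis using history_mono[of m t, OF _ alive_history] Suc by simp
  qed
  show ?thesis
  proof (cases "t = n")
    case True
    then have "{\<omega> \<in> \<Omega>. stopped n \<omega> = t} = {\<omega> \<in> \<Omega>. t \<le> stopped n \<omega>}"
      using stopped_le[of n] by (auto intro: antisym)
    then show ?thesis using ge by simp
  next
    case False
    with assms have "{\<omega> \<in> \<Omega>. stopped n \<omega> = t}
        = {\<omega> \<in> \<Omega>. t \<le> stopped n \<omega>} - {\<omega> \<in> \<Omega>. enat t < stop \<A> \<omega>}"
      using less_stopped_iff[of t n] by (auto simp: le_less)
    then show ?thesis using ge alive_history[of t] by simp
  qed
qed

text \<open>The fixed range of summation, with zero terms after stopping, lets expectations be taken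
  term by term; \<open>Z_eq\<close> recovers the sum up to the random time.\<close>

definition Z :: "nat \<Rightarrow> 'p trajectory \<Rightarrow> real" where
  "Z n \<omega> = (\<Sum>i<n. if enat i < stop \<A> \<omega> then z i \<omega> else 0)"

lemma Z_eq: "Z n \<omega> = (\<Sum>i<stopped n \<omega>. z i \<omega>)"
proof -
  have *: "{..<stopped n \<omega>} = {i \<in> {..<n}. enat i < stop \<A> \<omega>}"
    by (auto simp: less_stopped_iff)
  show ?thesis unfolding Z_def * by (rule sum.inter_filter[symmetric]) simp
qed

lemma measurable_Z [measurable]: "Z n \<in> borel_measurable (traj_space S)"
  unfolding Z_def by measurable

text \<open>On the event that the truncated stopping time equals \<open>t\<close>, the stopped likelihood ratio is
  the one at time \<open>t\<close>, so no martingale argument is needed.\<close>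

lemma nn_integral_stopped_likelihood:
  assumes G: "\<And>t. t \<le> n \<Longrightarrow> {\<omega> \<in> G. stopped n \<omega> = t} \<in> sets (history S (enat t))"
  shows "G \<in> sets (traj_space S)"
    and "(\<integral>\<^sup>+\<omega>. ennreal (exp (- Z n \<omega>)) * indicator G \<omega> \<partial>P) = emeasure Q G"
proof -
  let ?G = "\<lambda>t. {\<omega> \<in> G. stopped n \<omega> = t}"
  let ?L = "\<lambda>t \<omega>. \<Prod>i<t. ennreal (exp (- z i \<omega>))"
  have meas: "?G t \<in> sets (traj_space S)" if "t \<le> n" for t
    by (rule history_subset_traj[OF G[OF that]])
  have GU: "G = (\<Union>t\<in>{..n}. ?G t)" using stopped_le[of n] by auto
  show "G \<in> sets (traj_space S)"
    by (subst GU) (intro sets.finite_UN finite_atMost, use meas in auto)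
  \<comment> \<open>Exactly one summand can be nonzero, the one at
    \<open>t = stopped n \<omega>\<close>.\<close>
  have L: "ennreal (exp (- Z n \<omega>)) * indicator G \<omega> = (\<Sum>t\<le>n. ?L t \<omega> * indicator (?G t) \<omega>)" for \<omega>
  proof -
    have "(\<Sum>t\<le>n. ?L t \<omega> * indicator (?G t) \<omega>) = (\<Sum>t\<in>{stopped n \<omega>}. ?L t \<omega> * indicator (?G t) \<omega>)"
      using stopped_le[of n \<omega>] by (intro sum.mono_neutral_right) (auto simp: indicator_def)
    also have "\<dots> = ?L (stopped n \<omega>) \<omega> * indicator G \<omega>" by (simp add: indicator_def)
    also have "?L (stopped n \<omega>) \<omega> = ennreal (exp (- Z n \<omega>))"
      by (simp add: prod_ennreal Z_eq exp_sum flip: sum_negf)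
    finally show ?thesis by simp
  qed
  have "(\<integral>\<^sup>+\<omega>. ennreal (exp (- Z n \<omega>)) * indicator G \<omega> \<partial>P)
      = (\<Sum>t\<le>n. \<integral>\<^sup>+\<omega>. ?L t \<omega> * indicator (?G t) \<omega> \<partial>P)"
    unfolding L
  proof (rule nn_integral_sum)
    fix t assume "t \<in> {..n}"
    then have [measurable]: "?G t \<in> sets (traj_space S)" by (intro meas) simp
    show "(\<lambda>\<omega>. ?L t \<omega> * indicator (?G t) \<omega>) \<in> borel_measurable P" by measurable
  qed
  also have "\<dots> = (\<Sum>t\<le>n. emeasure Q (?G t))"
    by (intro sum.cong refl)
      (simp add: emeasure_traj_law_change[OF \<theta> \<eta> \<A> G] z_def)
  also have "\<dots> = emeasure Q (\<Union>t\<in>{..n}. ?G t)"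
    by (rule sum_emeasure) (auto simp: disjoint_family_on_def sets_traj_law[OF \<eta> \<A>] intro: meas)
  finally show "(\<integral>\<^sup>+\<omega>. ennreal (exp (- Z n \<omega>)) * indicator G \<omega> \<partial>P) = emeasure Q G"
    using GU by simp
qed

section \<open>Wald's identity, one round at a time\<close>

definition round_info :: "nat \<Rightarrow> ennreal" where
  "round_info i = (\<integral>\<^sup>+\<omega>. indicator {\<omega> \<in> \<Omega>. enat i < stop \<A> \<omega>} \<omega> * info i \<omega> \<partial>P)"

text \<open>Conditioning on the history and the action gives positive part =
  \<open>round_info i\<close> + negative part. The negative part is finite, because
  \<open>- z \<le> exp (- z)\<close> and the likelihood ratio of one round has conditional mean one;
  so a finite \<open>round_info i\<close> makes the term integrable.\<close>

lemma
  assumes "round_info i < \<top>"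
  shows integrable_stopped_z: "integrable P (\<lambda>\<omega>. if enat i < stop \<A> \<omega> then z i \<omega> else 0)"
    and integral_stopped_z: "(\<integral>\<omega>. (if enat i < stop \<A> \<omega> then z i \<omega> else 0) \<partial>P) = enn2real (round_info i)"
proof -
  let ?A = "{\<omega> \<in> \<Omega>. enat i < stop \<A> \<omega>}"
  let ?y = "\<lambda>\<omega>. if enat i < stop \<A> \<omega> then z i \<omega> else 0"
  let ?p = "\<integral>\<^sup>+\<omega>. ennreal (?y \<omega>) \<partial>P" and ?n = "\<integral>\<^sup>+\<omega>. ennreal (- ?y \<omega>) \<partial>P"
  let ?f = "\<lambda>y. log_ratio \<theta> \<eta> (fst y) (snd y)"
  let ?k = "\<lambda>y. KL (law \<theta> (fst y)) (law \<eta> (fst y))"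
  have pA: "?p = (\<integral>\<^sup>+\<omega>. indicator ?A \<omega> * ennreal (?f (\<omega> i)) \<partial>P)"
    by (intro nn_integral_cong) (auto simp: indicator_def z_def)
  have nA: "?n = (\<integral>\<^sup>+\<omega>. indicator ?A \<omega> * ennreal (- ?f (\<omega> i)) \<partial>P)"
    by (intro nn_integral_cong) (auto simp: indicator_def z_def)
  have one: "(\<integral>\<^sup>+\<omega>. indicator ?A \<omega> * ennreal (exp (- ?f (\<omega> i))) \<partial>P) = (\<integral>\<^sup>+\<omega>. indicator ?A \<omega> * 1 \<partial>P)"
  proof (rule nn_integral_traj_law_round[OF \<theta> \<A> alive_history])
    fix a assume "a \<in> space (action_space S)"
    interpret prob_space "sample_law \<theta> a" by (rule prob_space_sample_law[OF \<theta>])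
    show "(\<integral>\<^sup>+X. ennreal (exp (- ?f (a, X))) \<partial>sample_law \<theta> a) = (\<integral>\<^sup>+X. 1 \<partial>sample_law \<theta> a)"
      using nn_integral_exp_log_ratio[OF \<theta> \<eta>, of a] emeasure_space_1 by simp
  qed measurable
  have "?n \<le> (\<integral>\<^sup>+\<omega>. indicator ?A \<omega> * ennreal (exp (- ?f (\<omega> i))) \<partial>P)"
    unfolding nA
  proof (intro nn_integral_mono mult_left_mono ennreal_leI)
    show "- u \<le> exp (- u)" for u :: real using exp_ge_add_one_self[of "- u"] by linarith
  qed simp
  also have "\<dots> \<le> (\<integral>\<^sup>+\<omega>. 1 \<partial>P)"
    unfolding one by (intro nn_integral_mono) (auto simp: indicator_def)
  finally have n_fin: "?n < \<top>"
    using P.emeasure_space_1 by (auto simp: less_top[symmetric] top_unique)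
  have "?p = (\<integral>\<^sup>+\<omega>. indicator ?A \<omega> * (ennreal (?k (\<omega> i)) + ennreal (- ?f (\<omega> i))) \<partial>P)"
    unfolding pA
  proof (rule nn_integral_traj_law_round[OF \<theta> \<A> alive_history])
    fix a assume "a \<in> space (action_space S)"
    interpret prob_space "sample_law \<theta> a" by (rule prob_space_sample_law[OF \<theta>])
    show "(\<integral>\<^sup>+X. ennreal (?f (a, X)) \<partial>sample_law \<theta> a)
        = (\<integral>\<^sup>+X. ennreal (?k (a, X)) + ennreal (- ?f (a, X)) \<partial>sample_law \<theta> a)"
      using nn_integral_pos_log_ratio[OF \<theta> \<eta>, of a] emeasure_space_1
      by (simp add: nn_integral_add)
  qed measurable
  also have "\<dots> = (\<integral>\<^sup>+\<omega>. indicator ?A \<omega> * info i \<omega> + indicator ?A \<omega> * ennreal (- ?f (\<omega> i)) \<partial>P)"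
    by (simp add: info_def distrib_left)
  also have "\<dots> = round_info i + ?n"
    unfolding round_info_def nA
    by (rule nn_integral_add) measurable
  finally have p: "?p = round_info i + ?n" .
  then have p_fin: "?p < \<top>" using n_fin assms by simp
  show int: "integrable P ?y"
    unfolding real_integrable_def using p_fin n_fin by (auto simp: less_top)
  have "(\<integral>\<omega>. ?y \<omega> \<partial>P) = enn2real ?p - enn2real ?n"
    by (rule real_lebesgue_integral_def[OF int])
  also have "enn2real ?p = enn2real (round_info i) + enn2real ?n"
    unfolding p using assms n_fin by (rule enn2real_plus)
  finally show "(\<integral>\<omega>. ?y \<omega> \<partial>P) = enn2real (round_info i)" by simp
qed

section \<open>From error probabilities to information\<close>

text \<open>The tangents are placed at the likelihood ratios of the extremal two-point problem,
  where the event has probability \<open>1 - \<delta>\<close> under one law and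
  \<open>\<delta>\<close> under the other. This choice makes the bound linear in
  \<open>measure P G\<close>.\<close>

lemma stopped_information_bound:
  assumes G: "\<And>t. t \<le> n \<Longrightarrow> {\<omega> \<in> G. stopped n \<omega> = t} \<in> sets (history S (enat t))"
    and QG: "measure Q G \<le> \<delta>" and \<delta>: "0 < \<delta>" "\<delta> < 1 / 2"
  shows "ennreal ((2 * measure P G - 1) * ln ((1 - \<delta>) / \<delta>)) \<le> (\<Sum>i<n. round_info i)"
\<comment> \<open>An infinite sum leaves nothing to prove; a finite one makes every term of
  \<open>Z n\<close> integrable.\<close>
proof (cases "(\<Sum>i<n. round_info i) < \<top>")
  case True
  let ?H = "\<Omega> - G"
  have H: "{\<omega> \<in> ?H. stopped n \<omega> = t} \<in> sets (history S (enat t))" if "t \<le> n" for t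
  proof -
    have "{\<omega> \<in> ?H. stopped n \<omega> = t} = {\<omega> \<in> \<Omega>. stopped n \<omega> = t} - {\<omega> \<in> G. stopped n \<omega> = t}" by auto
    then show ?thesis using G[OF that] stopped_history[OF that] by simp
  qed
  note Gm = nn_integral_stopped_likelihood[OF G] and Hm = nn_integral_stopped_likelihood[OF H]
  have [measurable]: "G \<in> sets (traj_space S)" "?H \<in> sets (traj_space S)"
    using Gm(1) Hm(1) by auto
  have info_fin: "round_info i < \<top>" if "i < n" for i
    using True that by (simp add: less_top[symmetric])
  let ?E = "\<lambda>A \<omega>. exp (- Z n \<omega>) * indicator A \<omega>"
  have E: "integrable P (?E A) \<and> (\<integral>\<omega>. ?E A \<omega> \<partial>P) = measure Q A"
    if "(\<integral>\<^sup>+\<omega>. ennreal (exp (- Z n \<omega>)) * indicator A \<omega> \<partial>P) = emeasure Q A"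
      and [measurable]: "A \<in> sets (traj_space S)" for A
  proof -
    have eq: "(\<integral>\<^sup>+\<omega>. ennreal (?E A \<omega>) \<partial>P) = ennreal (measure Q A)"
      using that(1) by (simp add: ennreal_mult' ennreal_indicator Q.emeasure_eq_measure)
    then have "integrable P (?E A)" by (intro integrableI_nonneg) auto
    moreover have "(\<integral>\<omega>. ?E A \<omega> \<partial>P) = measure Q A"
      using eq by (subst integral_eq_nn_integral) auto
    ultimately show ?thesis by simp
  qed
  note EG = E[OF Gm(2,1)] and EH = E[OF Hm(2,1)]
  define l where "l = ln ((1 - \<delta>) / \<delta>)"
  define c where "c = (1 - \<delta>) / \<delta>"
  have c: "0 < c" using \<delta> by (simp add: c_def)
  \<comment> \<open>Both tangents in one formula: the constant is \<open>- 1 - l\<close> on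
    \<open>G\<close>, where the slope is \<open>c\<close>, and \<open>- 1 + l\<close> off
    \<open>G\<close>, where the slope is \<open>1 / c\<close>.\<close>
  let ?u = "\<lambda>\<omega>. c * ?E G \<omega> + ?E ?H \<omega> / c - 1 + l - 2 * l * indicator G \<omega>"
  have hc: "has_bochner_integral P (\<lambda>_. b) b" for b :: real
    using P.prob_space by (simp add: has_bochner_integral_iff)
  have hG: "has_bochner_integral P (\<lambda>\<omega>. indicator G \<omega> :: real) (measure P G)"
    by (rule has_bochner_integral_real_indicator) (auto simp: sets_traj_law[OF \<theta> \<A>] P.emeasure_eq_measure)
  have hEG: "has_bochner_integral P (?E G) (measure Q G)"
    and hEH: "has_bochner_integral P (?E ?H) (measure Q ?H)"
    using EG EH by (simp_all add: has_bochner_integral_iff)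
  have hu: "has_bochner_integral P ?u
      (c * measure Q G + measure Q ?H / c - 1 + l - 2 * l * measure P G)"
    by (intro has_bochner_integral_diff has_bochner_integral_add has_bochner_integral_mult_right
        has_bochner_integral_divide_zero hc hG hEG hEH)
  have intZ: "integrable P (Z n)"
    unfolding Z_def using info_fin by (intro Bochner_Integration.integrable_sum integrable_stopped_z) simp
  have "(\<integral>\<omega>. - Z n \<omega> \<partial>P) \<le> (\<integral>\<omega>. ?u \<omega> \<partial>P)"
  proof (rule integral_mono)
    show "integrable P (\<lambda>\<omega>. - Z n \<omega>)" using intZ by simp
    show "integrable P ?u" using hu by (rule integrable.intros)
    fix \<omega> assume "\<omega> \<in> space P"
    then have \<omega>: "\<omega> \<in> \<Omega>" by simp
    \<comment> \<open>The logarithm lies below its tangent at \<open>1 / x\<close>, which has slope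
      \<open>x\<close>.\<close>
    have tangent: "- Z n \<omega> \<le> x * exp (- Z n \<omega>) - 1 - ln x" if "0 < x" for x
    proof -
      have "ln (x * exp (- Z n \<omega>)) \<le> x * exp (- Z n \<omega>) - 1"
        using that by (intro ln_le_minus_one) simp
      then show ?thesis using that by (simp add: ln_mult)
    qed
    have "ln (1 / c) = - l" "ln c = l"
      using c by (simp_all add: l_def c_def ln_div)
    then show "- Z n \<omega> \<le> ?u \<omega>"
      using tangent[OF c] tangent[of "1 / c"] c \<omega> by (cases "\<omega> \<in> G") auto
  qed
  also have "\<dots> = c * measure Q G + measure Q ?H / c - 1 + l - 2 * l * measure P G"
    using hu by (rule has_bochner_integral_integral_eq)
  also have "measure Q ?H = 1 - measure Q G"
    using Q.prob_compl[of G] by (simp add: sets_traj_law[OF \<eta> \<A>])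
  \<comment> \<open>The left side increases with \<open>measure Q G\<close>, because
    \<open>1 / c \<le> c\<close>, and it is zero when that probability equals
    \<open>\<delta>\<close>.\<close>
  also have "c * measure Q G + (1 - measure Q G) / c - 1 \<le> 0"
  proof -
    have "1 \<le> c" using \<delta> by (simp add: c_def)
    then have "1 / c \<le> c" by (meson c divide_le_eq_1_pos order_trans)
    then have "(c - 1 / c) * measure Q G \<le> (c - 1 / c) * \<delta>"
      using QG by (intro mult_left_mono) auto
    moreover have "(c - 1 / c) * \<delta> + 1 / c - 1 = c * \<delta> + (1 / c) * (1 - \<delta>) - 1"
      by (simp add: algebra_simps flip: add_divide_distrib)
    moreover have "c * \<delta> = 1 - \<delta>" "(1 / c) * (1 - \<delta>) = \<delta>"
      using \<delta> by (simp_all add: c_def)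
    ultimately show ?thesis by (simp add: algebra_simps diff_divide_distrib)
  qed
  finally have "- (\<integral>\<omega>. Z n \<omega> \<partial>P) \<le> l - 2 * l * measure P G" by simp
  moreover have "(\<integral>\<omega>. Z n \<omega> \<partial>P) = (\<Sum>i<n. enn2real (round_info i))"
    unfolding Z_def using info_fin
    by (subst Bochner_Integration.integral_sum) (auto simp: integrable_stopped_z integral_stopped_z)
  ultimately have "(2 * measure P G - 1) * l \<le> (\<Sum>i<n. enn2real (round_info i))"
    by (simp add: algebra_simps)
  then have "ennreal ((2 * measure P G - 1) * l) \<le> ennreal (\<Sum>i<n. enn2real (round_info i))"
    by (rule ennreal_leI)
  also have "\<dots> = (\<Sum>i<n. round_info i)"
    using info_fin by (subst sum_ennreal[symmetric]) (auto intro!: sum.cong)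
  finally show ?thesis by (simp add: l_def)
next
  case False
  then have "(\<Sum>i<n. round_info i) = \<top>" using less_top by blast
  then show ?thesis by (simp only: top_greatest)
qed

definition total_info :: ennreal where
  "total_info = (\<integral>\<^sup>+\<omega>. (\<Sum>i. indicator {\<omega> \<in> \<Omega>. enat i < stop \<A> \<omega>} \<omega> * info i \<omega>) \<partial>P)"

lemma total_info_eq: "total_info = (\<Sum>i. round_info i)"
  unfolding total_info_def round_info_def by (rule nn_integral_suminf) measurable

text \<open>The truncated bound is applied to the part of \<open>E\<close> on which the algorithm
  stops by time \<open>n\<close>. Its probability under \<open>Q\<close> stays below that of
  \<open>E\<close>, and under \<open>P\<close> it increases to that of \<open>E\<close>, since
  \<open>E\<close> forces stopping in finite time.\<close>

lemma information_lower_bound: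
  assumes E: "\<And>t. {\<omega> \<in> E. stop \<A> \<omega> = enat t} \<in> sets (history S (enat t))"
    and fin: "\<And>\<omega>. \<omega> \<in> E \<Longrightarrow> stop \<A> \<omega> < \<infinity>"
    and PE: "1 - \<delta> \<le> measure P E" and QE: "measure Q E \<le> \<delta>" and \<delta>: "0 < \<delta>" "\<delta> < 1 / 2"
  shows "ennreal (kl (1 - \<delta>) \<delta>) \<le> total_info"
proof -
  let ?E = "\<lambda>n. {\<omega> \<in> E. stop \<A> \<omega> \<le> enat n}"
  let ?l = "ln ((1 - \<delta>) / \<delta>)"
  have l: "0 < ?l" using \<delta> by (intro ln_gt_zero) simp
  have EU: "E = (\<Union>n. ?E n)"
  proof safe
    fix \<omega> assume "\<omega> \<in> E"
    then obtain t where "stop \<A> \<omega> = enat t" using fin by (cases "stop \<A> \<omega>") force+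
    with \<open>\<omega> \<in> E\<close> show "\<omega> \<in> (\<Union>n. ?E n)" by auto
  qed
  have En: "{\<omega> \<in> ?E n. stopped n \<omega> = t} \<in> sets (history S (enat t))" if "t \<le> n" for n t
  proof -
    \<comment> \<open>For \<open>t = n\<close> the truncated time also equals \<open>n\<close> on
      trajectories that stop later; membership in \<open>?E n\<close> excludes them.\<close>
    have "{\<omega> \<in> ?E n. stopped n \<omega> = t} = {\<omega> \<in> E. stop \<A> \<omega> = enat t}"
    proof (intro Collect_cong)
      fix \<omega>
      show "(\<omega> \<in> ?E n \<and> stopped n \<omega> = t) = (\<omega> \<in> E \<and> stop \<A> \<omega> = enat t)"
        using that stopped_eq[of \<omega> n] by (cases "stop \<A> \<omega>") auto
    qed
    then show ?thesis using E by simp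
  qed
  have Em: "?E n \<in> sets (traj_space S)" for n
    by (rule nn_integral_stopped_likelihood(1)[OF En])
  have Es: "E \<in> sets (traj_space S)" by (subst EU) (use Em in auto)
  have bound: "ennreal ((2 * measure P (?E n) - 1) * ?l) \<le> total_info" for n
  proof -
    have "measure Q (?E n) \<le> measure Q E"
      using Es by (intro Q.finite_measure_mono) (auto simp: sets_traj_law[OF \<eta> \<A>])
    then have "ennreal ((2 * measure P (?E n) - 1) * ?l) \<le> (\<Sum>i<n. round_info i)"
      using QE \<delta> by (intro stopped_information_bound[OF En]) auto
    also have "\<dots> \<le> total_info"
      unfolding total_info_eq by (rule sum_le_suminf) auto
    finally show ?thesis .
  qed
  have "(\<lambda>n. measure P (?E n)) \<longlonglongrightarrow> measure P (\<Union>n. ?E n)"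
  proof (rule P.finite_Lim_measure_incseq)
    show "range ?E \<subseteq> sets P" using Em by (auto simp: sets_traj_law[OF \<theta> \<A>])
    show "incseq ?E" by (auto simp: incseq_def intro: order_trans)
  qed
  then have "(\<lambda>n. ennreal ((2 * measure P (?E n) - 1) * ?l)) \<longlonglongrightarrow> ennreal ((2 * measure P E - 1) * ?l)"
    unfolding EU[symmetric] by (intro tendsto_intros)
  then have "ennreal ((2 * measure P E - 1) * ?l) \<le> total_info"
    by (rule LIMSEQ_le_const2) (use bound in blast)
  moreover have "kl (1 - \<delta>) \<delta> \<le> (2 * measure P E - 1) * ?l"
    unfolding kl_complement[OF \<delta>(1) less_trans[OF \<delta>(2)], simplified]
    using PE l by (intro mult_right_mono) auto
  ultimately show ?thesis using ennreal_leI order_trans by blast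
qed

end

section \<open>The lower bound\<close>

lemma max_norm_less_iff: "max_norm M < e \<longleftrightarrow> (\<forall>j k. \<bar>M $ j $ k\<bar> < e)"
proof -
  have eq: "{\<bar>M $ j $ k\<bar> | j k. True} = (\<lambda>(j, k). \<bar>M $ j $ k\<bar>) ` UNIV" by auto
  show ?thesis unfolding max_norm_def eq by (subst Max_less_iff) auto
qed

text \<open>This is the source of the factor 2 in the radius of the alternatives: no estimate is
  within \<open>e\<close> of two matrices that are \<open>2 * e\<close> apart.\<close>

lemma max_norm_triangle_less:
  assumes "max_norm (X - A) < e" "max_norm (X - B) < e"
  shows "max_norm (B - A) < 2 * e"
  unfolding max_norm_less_iff
proof (intro allI)
  fix j k
  have "\<bar>X $ j $ k - A $ j $ k\<bar> < e" "\<bar>X $ j $ k - B $ j $ k\<bar> < e"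
    using assms by (auto simp: max_norm_less_iff)
  then show "\<bar>(B - A) $ j $ k\<bar> < 2 * e" by simp
qed

lemma measurable_matrix_nth: "(\<lambda>X::real^'n^'m. X $ i $ k) \<in> borel_measurable borel"
  by (intro borel_measurable_continuous_onI continuous_intros)

lemma suminf_indicator_less_enat:
  "(\<Sum>i. if enat i < t then 1 else 0) = ennreal_of_enat t"
proof -
  have "(\<Sum>i. if enat i < t then 1 else 0) = (\<integral>\<^sup>+i. indicator {i. enat i < t} i \<partial>count_space UNIV)"
    by (subst nn_integral_count_space_nat) (intro suminf_cong, simp add: indicator_def)
  also have "\<dots> = emeasure (count_space UNIV) {i. enat i < t}" by simp
  also have "\<dots> = ennreal_of_enat t"
    by (cases t) (simp_all add: emeasure_count_space lessThan_def[symmetric])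
  finally show ?thesis .
qed

section \<open>Separation of the parameter from its alternatives\<close>

context two_models
begin

text \<open>No answer is right for both \<open>\<theta>\<close> and \<open>\<eta>\<close>, so
  correctness under \<open>\<eta>\<close> bounds the probability under \<open>\<eta>\<close> of
  answering \<open>\<theta>\<close> by \<open>\<delta>\<close>.\<close>

lemma information_lower_bound_alternative:
  assumes Alt: "\<eta> \<in> Alt S (2 * \<epsilon>) \<theta>" and \<theta>S: "\<theta> \<in> Theta S" and correct: "correct_alg S \<epsilon> \<delta> \<A>"
    and \<delta>: "0 < \<delta>" "\<delta> < 1 / 2"
  shows "ennreal (kl (1 - \<delta>) \<delta>) \<le> total_info"
proof -
  define E where "E \<theta> = {\<omega> \<in> \<Omega>. stop \<A> \<omega> < \<infinity> \<and>
      graph (estimate \<A> (the_enat (stop \<A> \<omega>)) \<omega>) = graph \<theta> \<and>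
      max_norm (coef (estimate \<A> (the_enat (stop \<A> \<omega>)) \<omega>) - coef \<theta>) < \<epsilon>}" for \<theta> :: "'p sem"
  have PE: "1 - \<delta> \<le> measure P (E \<theta>)" and QE: "1 - \<delta> \<le> measure Q (E \<eta>)"
    using correct \<theta>S Alt by (auto simp: correct_alg_def E_def Alt_def)
  have "E \<theta> \<inter> E \<eta> = {}"
    using Alt max_norm_triangle_less[of _ "coef \<theta>" \<epsilon> "coef \<eta>"] by (auto simp: E_def Alt_def not_less)
  \<comment> \<open>\<open>measure\<close> is zero on non-measurable sets, whereas correctness gives
    these events at least \<open>1 - \<delta> > 0\<close>.\<close>
  moreover have "E \<theta> \<in> sets Q" "E \<eta> \<in> sets Q"
    using PE QE \<delta> measure_notin_sets[of "E \<theta>" P] measure_notin_sets[of "E \<eta>" Q]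
    by (fastforce simp: sets_traj_law \<theta> \<eta> \<A>)+
  ultimately have "measure Q (E \<theta>) + measure Q (E \<eta>) = measure Q (E \<theta> \<union> E \<eta>)"
    by (simp add: Q.finite_measure_Union)
  also have "\<dots> \<le> 1" by (rule Q.prob_le_1)
  finally have Q\<theta>: "measure Q (E \<theta>) \<le> \<delta>" using QE by simp
  show ?thesis
  proof (rule information_lower_bound[OF _ _ PE Q\<theta> \<delta>])
    fix t
    let ?F = "history S (enat t)"
    have g: "(\<lambda>\<omega>. graph (estimate \<A> t \<omega>)) \<in> ?F \<rightarrow>\<^sub>M count_space UNIV"
      and c: "(\<lambda>\<omega>. coef (estimate \<A> t \<omega>)) \<in> borel_measurable ?F"
      using \<A> by (simp_all add: is_algorithm_def)
    note measurable_compose[OF c measurable_matrix_nth, measurable]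
    have "{\<omega> \<in> space ?F. graph (estimate \<A> t \<omega>) = graph \<theta>} \<in> sets ?F"
      using measurable_sets[OF g, of "{graph \<theta>}"] by (simp add: vimage_def Int_def conj_commute)
    moreover have "{\<omega> \<in> space ?F. \<forall>j k. \<bar>coef (estimate \<A> t \<omega>) $ j $ k - coef \<theta> $ j $ k\<bar> < \<epsilon>} \<in> sets ?F"
      by measurable
    \<comment> \<open>This event says that the algorithm does not stop before \<open>t\<close>; with
      \<open>stop \<A> \<omega> \<le> enat t\<close> it isolates the slice on which the final
      estimate is the one at time \<open>t\<close>.\<close>
    moreover have "{\<omega> \<in> \<Omega>. stopped t \<omega> = t} \<in> sets ?F" by (rule stopped_history) simp
    moreover note stop_le_history[of t]
    ultimately have mem: "{\<omega> \<in> \<Omega>. stopped t \<omega> = t} \<inter> {\<omega> \<in> \<Omega>. stop \<A> \<omega> \<le> enat t}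
        \<inter> {\<omega> \<in> space ?F. graph (estimate \<A> t \<omega>) = graph \<theta>}
        \<inter> {\<omega> \<in> space ?F. \<forall>j k. \<bar>coef (estimate \<A> t \<omega>) $ j $ k - coef \<theta> $ j $ k\<bar> < \<epsilon>} \<in> sets ?F"
      by blast
    have "{\<omega> \<in> \<Omega>. stopped t \<omega> = t} \<inter> {\<omega> \<in> \<Omega>. stop \<A> \<omega> \<le> enat t}
        \<inter> {\<omega> \<in> space ?F. graph (estimate \<A> t \<omega>) = graph \<theta>}
        \<inter> {\<omega> \<in> space ?F. \<forall>j k. \<bar>coef (estimate \<A> t \<omega>) $ j $ k - coef \<theta> $ j $ k\<bar> < \<epsilon>}
      = {\<omega> \<in> E \<theta>. stop \<A> \<omega> = enat t}"
    proof (rule set_eqI)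
      fix \<omega>
      have *: "stopped t \<omega> = t \<and> stop \<A> \<omega> \<le> enat t \<longleftrightarrow> stop \<A> \<omega> = enat t"
        using stopped_eq[of \<omega> t] by (cases "stop \<A> \<omega>") auto
      show "\<omega> \<in> {\<omega> \<in> \<Omega>. stopped t \<omega> = t} \<inter> {\<omega> \<in> \<Omega>. stop \<A> \<omega> \<le> enat t}
          \<inter> {\<omega> \<in> space ?F. graph (estimate \<A> t \<omega>) = graph \<theta>}
          \<inter> {\<omega> \<in> space ?F. \<forall>j k. \<bar>coef (estimate \<A> t \<omega>) $ j $ k - coef \<theta> $ j $ k\<bar> < \<epsilon>}
        \<longleftrightarrow> \<omega> \<in> {\<omega> \<in> E \<theta>. stop \<A> \<omega> = enat t}"
      proof (cases "stop \<A> \<omega> = enat t")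
        case True
        with * have "stopped t \<omega> = t" by simp
        with True show ?thesis by (simp add: space_history E_def max_norm_less_iff) blast
      next
        case False
        with * show ?thesis by auto
      qed
    qed
    with mem show "{\<omega> \<in> E \<theta>. stop \<A> \<omega> = enat t} \<in> sets ?F" by simp
  qed (auto simp: E_def)
qed

end

section \<open>The visit measure of the actions\<close>

text \<open>The occupation measure: each set of actions gets the expected number of played rounds
  that use it. It is left unnormalised because its total mass, the expected stopping time, may be
  zero or infinite.\<close>

definition visit_measure :: "'p::finite setting \<Rightarrow> 'p algorithm \<Rightarrow> 'p sem \<Rightarrow> 'p action measure" where
  "visit_measure S \<A> \<theta> =
     distr (density (traj_law S \<A> \<theta> \<Otimes>\<^sub>M count_space UNIV) (\<lambda>(\<omega>, i). if enat i < stop \<A> \<omega> then 1 else 0))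
       (action_space S) (\<lambda>(\<omega>, i). fst (\<omega> i))"

lemma nn_integral_visit_measure:
  fixes f :: "'p::finite action \<Rightarrow> ennreal"
  assumes \<theta>: "regular_sem \<theta>" and \<A>: "is_algorithm S \<A>"
    and f[measurable]: "f \<in> borel_measurable (action_space S)"
  shows "(\<integral>\<^sup>+a. f a \<partial>visit_measure S \<A> \<theta>)
    = (\<integral>\<^sup>+\<omega>. (\<Sum>i. (if enat i < stop \<A> \<omega> then 1 else 0) * f (fst (\<omega> i))) \<partial>traj_law S \<A> \<theta>)"
proof -
  \<comment> \<open>With \<open>\<theta>\<close> in both places the locale supplies the
    measurability of the events that a round is played.\<close>
  interpret two_models S \<A> \<theta> \<theta> by unfold_locales fact+
  interpret N: sigma_finite_measure "count_space (UNIV :: nat set)"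
    by (rule sigma_finite_measure_count_space)
  let ?N = "P \<Otimes>\<^sub>M count_space (UNIV :: nat set)"
  \<comment> \<open>The index of the round is discrete and countable, so measurability for each
    fixed round gives joint measurability.\<close>
  have comp: "(\<lambda>p. g (snd p) (fst p)) \<in> ?N \<rightarrow>\<^sub>M M" if "\<And>i. g i \<in> traj_space S \<rightarrow>\<^sub>M M"
    for g :: "nat \<Rightarrow> 'p trajectory \<Rightarrow> 'b" and M :: "'b measure"
    using that measurable_compose_countable'[of UNIV "\<lambda>i p. g i (fst p)" ?N M snd]
    by (simp add: measurable_compose[OF measurable_fst] measurable_cong_sets[OF sets_traj_law[OF \<theta> \<A>] refl])
  have [measurable]: "fst \<in> round_space S \<rightarrow>\<^sub>M action_space S" unfolding round_space_def by simp
  have act: "(\<lambda>(\<omega>, i). fst (\<omega> i)) \<in> ?N \<rightarrow>\<^sub>M action_space S"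
    unfolding case_prod_beta' by (rule comp) measurable
  have wt: "(\<lambda>(\<omega>, i). if enat i < stop \<A> \<omega> then 1 else 0 :: ennreal) \<in> borel_measurable ?N"
    unfolding case_prod_beta' by (rule comp) measurable
  have act': "(\<lambda>(\<omega>, i). fst (\<omega> i)) \<in> density ?N (\<lambda>(\<omega>, i). if enat i < stop \<A> \<omega> then 1 else 0) \<rightarrow>\<^sub>M action_space S"
    using act by simp
  have fa: "(\<lambda>p. f (case p of (\<omega>, i) \<Rightarrow> fst (\<omega> i))) \<in> borel_measurable ?N"
    using measurable_compose[OF act f] .
  have "(\<integral>\<^sup>+a. f a \<partial>visit_measure S \<A> \<theta>)
    = (\<integral>\<^sup>+p. (case p of (\<omega>, i) \<Rightarrow> if enat i < stop \<A> \<omega> then 1 else 0) * f (case p of (\<omega>, i) \<Rightarrow> fst (\<omega> i)) \<partial>?N)"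
    unfolding visit_measure_def
    using nn_integral_distr[OF act', of f] nn_integral_density[OF wt fa] f by simp
  also have "\<dots> = (\<integral>\<^sup>+\<omega>. \<integral>\<^sup>+i. (if enat i < stop \<A> \<omega> then 1 else 0) * f (fst (\<omega> i)) \<partial>count_space UNIV \<partial>P)"
    using N.nn_integral_fst[OF borel_measurable_times_ennreal[OF wt fa]] by simp
  finally show ?thesis by (simp add: nn_integral_count_space_nat)
qed

lemma emeasure_visit_measure:
  assumes \<theta>: "regular_sem \<theta>" and \<A>: "is_algorithm S \<A>"
  shows "emeasure (visit_measure S \<A> \<theta>) (space (visit_measure S \<A> \<theta>)) = expected_stop S \<A> \<theta>"
  using nn_integral_visit_measure[OF \<theta> \<A>, of "\<lambda>_. 1"]
  by (simp add: suminf_indicator_less_enat expected_stop_def)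

lemma kl_pos:
  assumes "0 < \<delta>" "\<delta> < 1 / 2"
  shows "0 < kl (1 - \<delta>) \<delta>"
  using assms by (subst kl_complement) (auto intro!: mult_pos_pos ln_gt_zero)

text \<open>For every alternative the total information is an integral against the same visit
  measure. After normalisation this measure competes in the supremum that defines
  \<open>info_complexity\<close>.\<close>

lemma expected_stop_lower_bound:
  fixes S :: "'p::finite setting"
  assumes S: "valid_setting S" and \<theta>S: "\<theta> \<in> Theta S"
    and \<delta>: "0 < \<delta>" "\<delta> < 1 / 2" and \<A>: "is_algorithm S \<A>" and correct: "correct_alg S \<epsilon> \<delta> \<A>"
  shows "ennreal (kl (1 - \<delta>) \<delta>) / info_complexity S (2 * \<epsilon>) \<theta> \<le> expected_stop S \<A> \<theta>"
proof -
  let ?k = "ennreal (kl (1 - \<delta>) \<delta>)" and ?C = "info_complexity S (2 * \<epsilon>) \<theta>" and ?T = "expected_stop S \<A> \<theta>"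
  let ?V = "visit_measure S \<A> \<theta>" and ?I = "\<lambda>\<eta> a. ennreal (KL (law \<theta> a) (law \<eta> a))"
  have \<theta>: "regular_sem \<theta>" by (rule Theta_regular[OF S \<theta>S])
  have sV: "sets ?V = sets (action_space S)" by (simp add: visit_measure_def)
  have meas: "?I \<eta> \<in> borel_measurable (action_space S)" if "\<eta> \<in> Alt S (2 * \<epsilon>) \<theta>" for \<eta>
    using measurable_KL_law[OF \<theta> Theta_regular[OF S], of \<eta> S] that by (simp add: Alt_def)
  have key: "?k \<le> (\<integral>\<^sup>+a. ?I \<eta> a \<partial>?V)" if alt: "\<eta> \<in> Alt S (2 * \<epsilon>) \<theta>" for \<eta>
  proof -
    interpret two_models S \<A> \<theta> \<eta>
      by unfold_locales (use \<theta> \<A> alt Theta_regular[OF S] in \<open>auto simp: Alt_def\<close>)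
    have "?k \<le> total_info" by (rule information_lower_bound_alternative[OF alt \<theta>S correct \<delta>])
    also have "\<dots> = (\<integral>\<^sup>+a. ?I \<eta> a \<partial>?V)"
      unfolding total_info_def nn_integral_visit_measure[OF \<theta> \<A> meas[OF alt]] info_def
      by (intro nn_integral_cong suminf_cong) (auto simp: indicator_def)
    finally show ?thesis .
  qed
  have kpos: "0 < ?k" using kl_pos[OF \<delta>] by simp
  \<comment> \<open>Without a probability measure on the actions the supremum would be 0; the point
    mass at passive observation is one, so the complexity is infinite when there are no
    alternatives.\<close>
  have nonempty: "{w. prob_space w \<and> sets w = sets (action_space S)} \<noteq> {}"
  proof -
    have "(None, 0) \<in> space (action_space S)" by (simp add: space_action_space actions_def)
    then have "return (action_space S) (None, 0) \<in> {w. prob_space w \<and> sets w = sets (action_space S)}"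
      by (simp add: prob_space_return)
    then show ?thesis by (rule ex_in_conv[THEN iffD1, OF exI])
  qed
  consider "Alt S (2 * \<epsilon>) \<theta> = {}" | "?T = \<top>" | "Alt S (2 * \<epsilon>) \<theta> \<noteq> {}" "?T \<noteq> \<top>" by blast
  then show ?thesis
  proof cases
    case 1
    then have "?C = \<top>" unfolding info_complexity_def using nonempty by simp
    then show ?thesis by simp
  next
    case 2
    then show ?thesis by (simp only: top_greatest)
  next
    case 3
    \<comment> \<open>A visit measure without mass carries no information, which contradicts the
      positive lower bound for any one alternative.\<close>
    have T0: "?T \<noteq> 0"
    proof
      assume "?T = 0"
      then have V0: "emeasure ?V (space ?V) = 0" by (simp add: emeasure_visit_measure[OF \<theta> \<A>])
      obtain \<eta> where \<eta>: "\<eta> \<in> Alt S (2 * \<epsilon>) \<theta>" using 3 by blast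
      have "AE a in ?V. ?I \<eta> a = 0"
        using V0 by (intro AE_I[of _ _ "space ?V"]) auto
      then have "(\<integral>\<^sup>+a. ?I \<eta> a \<partial>?V) = 0"
        using nn_integral_cong_AE[of "?I \<eta>" "\<lambda>_. 0" ?V] by simp
      then show False using key[OF \<eta>] kpos by simp
    qed
    define w where "w = density ?V (\<lambda>_. 1 / ?T)"
    have T1: "?T * (1 / ?T) = 1"
      using T0 3 by (simp add: ennreal_times_divide less_top)
    have w_int: "?T * (\<integral>\<^sup>+a. f a \<partial>w) = (\<integral>\<^sup>+a. f a \<partial>?V)" if "f \<in> borel_measurable (action_space S)" for f
    proof -
      have "f \<in> borel_measurable ?V" using that by (simp add: measurable_cong_sets[OF sV refl])
      then have "(\<integral>\<^sup>+a. f a \<partial>w) = (1 / ?T) * (\<integral>\<^sup>+a. f a \<partial>?V)"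
        unfolding w_def by (simp add: nn_integral_density nn_integral_cmult)
      then show ?thesis using T1 by (simp add: mult.assoc[symmetric])
    qed
    have sw: "sets w = sets (action_space S)" by (simp add: w_def sV)
    have "prob_space w"
    proof
      have "emeasure w (space w) = (1 / ?T) * ?T"
        by (simp add: w_def emeasure_density emeasure_visit_measure[OF \<theta> \<A>])
      then show "emeasure w (space w) = 1" using T1 by (simp add: mult.commute)
    qed
    have "?k \<le> ?T * (INF \<eta>\<in>Alt S (2 * \<epsilon>) \<theta>. \<integral>\<^sup>+a. ?I \<eta> a \<partial>w)"
    proof -
      \<comment> \<open>The left side does not depend on \<open>\<eta>\<close>, so a bound for each
        alternative bounds the infimum.\<close>
      have "?k / ?T \<le> (INF \<eta>\<in>Alt S (2 * \<epsilon>) \<theta>. \<integral>\<^sup>+a. ?I \<eta> a \<partial>w)"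
      proof (rule INF_greatest)
        fix \<eta> assume \<eta>: "\<eta> \<in> Alt S (2 * \<epsilon>) \<theta>"
        show "?k / ?T \<le> (\<integral>\<^sup>+a. ?I \<eta> a \<partial>w)"
          using T0 key[OF \<eta>] by (intro divide_le_posI_ennreal) (auto simp: w_int[OF meas[OF \<eta>]] zero_less_iff_neq_zero)
      qed
      then have "?T * (?k / ?T) \<le> ?T * (INF \<eta>\<in>Alt S (2 * \<epsilon>) \<theta>. \<integral>\<^sup>+a. ?I \<eta> a \<partial>w)"
        by (rule mult_left_mono) simp
      moreover have "?T * (?k / ?T) = ?k"
        using T1 by (metis ennreal_times_divide mult.commute mult.right_neutral)
      ultimately show ?thesis by simp
    qed
    also have "\<dots> \<le> ?T * ?C"
      unfolding info_complexity_def using sw \<open>prob_space w\<close>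
      by (intro mult_left_mono SUP_upper) auto
    finally have kTC: "?k \<le> ?C * ?T" by (simp add: mult.commute)
    moreover from kTC kpos have "0 < ?C" by (auto simp: zero_less_iff_neq_zero)
    ultimately show ?thesis by (intro divide_le_posI_ennreal)
  qed
qed

section \<open>Asymptotics for small error probability\<close>

lemma kl_over_log_tendsto: "((\<lambda>\<delta>. kl (1 - \<delta>) \<delta> / ln (1 / \<delta>)) \<longlongrightarrow> 1) (at_right 0)"
  unfolding kl_def by real_asymp

theorem theorem3p3:
  fixes S :: "'p::finite setting" and \<epsilon> :: real and \<theta> :: "'p sem"
  assumes "valid_setting S"
    and "0 < \<epsilon>" and "\<epsilon> \<le> beta_min S / 2"
    and "\<theta> \<in> Theta S"
  shows "(\<forall>\<delta> \<A>. 0 < \<delta> \<and> \<delta> < 1 / 2 \<and> is_algorithm S \<A> \<and> correct_alg S \<epsilon> \<delta> \<A> \<longrightarrow>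
            expected_stop S \<A> \<theta> \<ge> ennreal (kl (1 - \<delta>) \<delta>) / info_complexity S (2 * \<epsilon>) \<theta>)
       \<and> (\<forall>\<A> :: real \<Rightarrow> 'p algorithm.
            (\<forall>\<delta>. 0 < \<delta> \<and> \<delta> < 1 / 2 \<longrightarrow> is_algorithm S (\<A> \<delta>) \<and> correct_alg S \<epsilon> \<delta> (\<A> \<delta>)) \<longrightarrow>
            Liminf (at_right 0) (\<lambda>\<delta>. expected_stop S (\<A> \<delta>) \<theta> / ennreal (ln (1 / \<delta>)))
              \<ge> 1 / info_complexity S (2 * \<epsilon>) \<theta>)"
proof (intro conjI allI impI)
  show "ennreal (kl (1 - \<delta>) \<delta>) / info_complexity S (2 * \<epsilon>) \<theta> \<le> expected_stop S \<A> \<theta>"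
    if "0 < \<delta> \<and> \<delta> < 1 / 2 \<and> is_algorithm S \<A> \<and> correct_alg S \<epsilon> \<delta> \<A>" for \<delta> \<A>
    using that assms by (intro expected_stop_lower_bound) auto
next
  fix \<A> :: "real \<Rightarrow> 'p algorithm"
  assume \<A>: "\<forall>\<delta>. 0 < \<delta> \<and> \<delta> < 1 / 2 \<longrightarrow> is_algorithm S (\<A> \<delta>) \<and> correct_alg S \<epsilon> \<delta> (\<A> \<delta>)"
  let ?C = "info_complexity S (2 * \<epsilon>) \<theta>"
  \<comment> \<open>The first bound divided by \<open>ln (1 / \<delta>)\<close>, with the constant
    factor \<open>1 / ?C\<close> split off. The other factor tends to 1, so the limit of the product
    exists even if \<open>1 / ?C\<close> is zero or infinite.\<close>
  let ?g = "\<lambda>\<delta>. ennreal (kl (1 - \<delta>) \<delta> / ln (1 / \<delta>)) * (1 / ?C)"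
  have "(?g \<longlongrightarrow> ennreal 1 * (1 / ?C)) (at_right 0)"
    by (intro tendsto_mult_ennreal tendsto_ennrealI kl_over_log_tendsto tendsto_const) auto
  then have "1 / ?C = Liminf (at_right 0) ?g"
    using lim_imp_Liminf[of "at_right (0::real)" ?g] by simp
  also have "\<dots> \<le> Liminf (at_right 0) (\<lambda>\<delta>. expected_stop S (\<A> \<delta>) \<theta> / ennreal (ln (1 / \<delta>)))"
  proof (rule Liminf_mono)
    have "eventually (\<lambda>\<delta>. \<delta> \<in> {0<..<1/2 :: real}) (at_right 0)"
      by (rule eventually_at_right_real) simp
    then show "\<forall>\<^sub>F \<delta> in at_right 0. ?g \<delta> \<le> expected_stop S (\<A> \<delta>) \<theta> / ennreal (ln (1 / \<delta>))"
    proof eventually_elim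
      case (elim \<delta>)
      then have \<delta>: "0 < \<delta>" "\<delta> < 1 / 2" by auto
      then have l: "0 < ln (1 / \<delta>)" by (intro ln_gt_zero) simp
      have "?g \<delta> = (ennreal (kl (1 - \<delta>) \<delta>) / ennreal (ln (1 / \<delta>))) * (1 / ?C)"
        using kl_pos[OF \<delta>] l by (simp add: divide_ennreal)
      also have "\<dots> = (ennreal (kl (1 - \<delta>) \<delta>) / ?C) / ennreal (ln (1 / \<delta>))"
        by (simp add: divide_ennreal_def mult_ac)
      also have "\<dots> \<le> expected_stop S (\<A> \<delta>) \<theta> / ennreal (ln (1 / \<delta>))"
        using \<A> \<delta> assms by (intro divide_right_mono_ennreal expected_stop_lower_bound) auto
      finally show ?case .
    qed
  qed
  finally show "1 / ?C \<le> Liminf (at_right 0) (\<lambda>\<delta>. expected_stop S (\<A> \<delta>) \<theta> / ennreal (ln (1 / \<delta>)))" .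
qed

end
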